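(* Let $V(x,t,p)$ be the value function of the optimal switching problem and let $\{V_p\}_{p\in\mathcal I}$ be the backwardly defined value functions of the optimal stopping problems, both described in the context. For all $x\in\mathbb R^d$, $t\in[0,T]$ and $p\in\mathcal I$ with $p\neq\bar p$, $$V(x,t,p)=\inf_{\alpha\in\mathcal A,\ \tau\in[t,T],\ p'\in\mathcal I_p}\left(\int_t^{\tau}e^{-\lambda(s-t)}\ell(y(s),\alpha(s),p,s)\,ds+e^{-\lambda(\tau-t)}\Big(C(y(\tau),p,p')+V_{p'}(y(\tau),\tau)\Big)\right),$$ where $y$ is the solution of $y'(s)=f(y(s),\alpha(s),p)$ for a.e. $s\in\,]t,T]$, $y(t)=x$. As a consequence, $V(x,t,p)=V_p(x,t)$ for all $(x,t,p)\in\mathbb R^d\times[0,T]\times\mathcal I$.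
   Context: Data. $N\ge1$ is an integer, $\mathcal I=\{0,1\}^N$, $\bar p=(1,\dots,1)\in\mathcal I$, $T>0$, $\lambda\ge0$, $A\subset\mathbb R^m$ is compact (nonempty), and $\mathcal A=\{\alpha:[0,+\infty[\to A \text{ measurable}\}$. For $p=(p^1,\dots,p^N)\in\mathcal I$, $$\mathcal I_p=\{\tilde p\in\mathcal I:\ p^i=1\Rightarrow\tilde p^i=1,\ \text{and there is } l \text{ with } p^l=0,\ \tilde p^l=1\},$$ so $\mathcal I_{\bar p}=\emptyset$. Assumptions. $f:\mathbb R^d\times A\times\mathcal I\to\mathbb R^d$ is continuous, bounded, and there is $L>0$ with $\|f(x,a,p)-f(y,a,p)\|\le L\|x-y\|$ for all $x,y\in\mathbb R^d$, $a\in A$, $p\in\mathcal I$. $\ell:\mathbb R^d\times A\times\mathcal I\times[0,T]\to[0,+\infty[$ is bounded, continuous, and uniformly continuous with respect to $x$ uniformly with respect to $(a,p,t)$. $C:\mathbb R^d\times\mathcal I\times\mathcal I\to[0,+\infty[$ is uniformly continuous with respect to $x$, uniformly with respect to $p\in\mathcal I$, $p'\in\mathcal I_p$. Optimal switching problem. For $p\ne\bar p$ and $t\in[0,T]$, $\mathcal U_{(p,t)}$ is the set of all $u=(\alpha,m,t_1,\dots,t_m,p_1,\dots,p_{m-1})$ with $\alpha\in\mathcal A$, $1\le m\le N-\sum_i p^i$, switching instants $t\le t_1\le t_2\le\dots\le t_m\le T$, and destinations $p_1,\dots,p_{m-1},p_m=\bar p$ with $p_1\in\mathcal I_p$ and $p_{i+1}\in\mathcal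 I_{p_i}$ for $i=1,\dots,m-1$. With $p_0=p$, $t_0=t$, let $y$ be the absolutely continuous solution of $y(t)=x$, $y'(s)=f(y(s),\alpha(s),p_{j-1})$ for a.e. $s\in[t_{j-1},t_j]$, $j=1,\dots,m$. The cost is $$J(x,t,p,u)=\sum_{j=1}^m\left(\int_{t_{j-1}}^{t_j}e^{-\lambda(s-t)}\ell(y(s),\alpha(s),p_{j-1},s)\,ds+e^{-\lambda(t_j-t)}C(y(t_j),p_{j-1},p_j)\right),$$ and $V(x,t,p)=\inf_{u\in\mathcal U_{(p,t)}}J(x,t,p,u)$; moreover $V(\cdot,\cdot,\bar p)\equiv0$. Family of optimal stopping problems. Set $V_{\bar p}\equiv0$. Proceeding backwardly (by induction on the number of zeros of $p$), for $p\ne\bar p$ and $(x,t)\in\mathbb R^d\times[0,T]$ define $$V_p(x,t)=\inf_{\alpha\in\mathcal A,\ \tau\in[t,T],\ p'\in\mathcal I_p}\left(\int_t^{\tau}e^{-\lambda(s-t)}\ell(y(s),\alpha(s),p,s)\,ds+e^{-\lambda(\tau-t)}\big(C(y(\tau),p,p')+V_{p'}(y(\tau),\tau)\big)\right),$$ where $y'(s)=f(y(s),\alpha(s),p)$ for a.e. $s\in\,]t,T]$, $y(t)=x$. *)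

theory Defs
  imports "HOL-Analysis.Analysis"
begin

text \<open>
  The dimensions are types: the state space is \<^typ>\<open>real ^ 'd\<close>, the controls lie in a subset of
  \<^typ>\<open>real ^ 'm\<close>, and the set of modes, $\{0,1\}^N$ with $N \ge 1$, is \<^typ>\<open>bool ^ 'n\<close> with
  $N$ the cardinality of \<^typ>\<open>'n\<close>. The topology of \<^typ>\<open>bool ^ 'n\<close> is discrete.
\<close>

type_synonym 'n mode = "bool ^ 'n"

type_synonym ('d, 'm, 'n) dynamics = "real ^ 'd \<Rightarrow> real ^ 'm \<Rightarrow> 'n mode \<Rightarrow> real ^ 'd"

type_synonym ('d, 'm, 'n) running_cost = "real ^ 'd \<Rightarrow> real ^ 'm \<Rightarrow> 'n mode \<Rightarrow> real \<Rightarrow> real"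

type_synonym ('d, 'n) switching_cost = "real ^ 'd \<Rightarrow> 'n mode \<Rightarrow> 'n mode \<Rightarrow> real"

type_synonym 'm control = "real \<Rightarrow> real ^ 'm"

definition final_mode :: "'n::finite mode" where
  "final_mode = (\<chi> i. True)"

definition reachable :: "'n::finite mode \<Rightarrow> 'n mode set" where
  "reachable p = {p'. (\<forall>i. p $ i \<longrightarrow> p' $ i) \<and> (\<exists>l. \<not> p $ l \<and> p' $ l)}"

text \<open>
  A control is a Lebesgue measurable map from $[0,+\infty[$ to $A$. Its values at negative times are
  irrelevant.
\<close>

definition controls :: "(real ^ 'm::finite) set \<Rightarrow> 'm control set" where
  "controls A = measurable (lebesgue_on {0..}) (restrict_space borel A)"

text \<open>
  Absolute continuity of a function on \<open>{a..b}\<close>: a finite family of non-overlapping closed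
  subintervals is a division of its union.
\<close>

definition abs_cont_on :: "real \<Rightarrow> real \<Rightarrow> (real \<Rightarrow> 'a::real_normed_vector) \<Rightarrow> bool" where
  "abs_cont_on a b y \<longleftrightarrow>
     (\<forall>\<epsilon>>0. \<exists>\<delta>>0. \<forall>\<D> S. \<D> division_of S \<and> S \<subseteq> {a..b} \<and> (\<Sum>K\<in>\<D>. Sup K - Inf K) < \<delta>
        \<longrightarrow> (\<Sum>K\<in>\<D>. norm (y (Sup K) - y (Inf K))) < \<epsilon>)"

text \<open>
  A switching control $u = (\alpha, m, t_1, \dots, t_m, p_1, \dots, p_{m-1})$ is a tuple
  \<open>(\<alpha>, m, ts, ps)\<close>, with \<open>ts\<close> the list of the $t_j$ and \<open>ps\<close> the list of the $p_j$. The following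
  functions add the conventions $t_0 = t$, $p_0 = p$ and $p_m = \bar p$.
\<close>

type_synonym ('m, 'n) switching_control = "'m control \<times> nat \<times> real list \<times> 'n mode list"

definition instant :: "real \<Rightarrow> real list \<Rightarrow> nat \<Rightarrow> real" where
  "instant t ts j = (t # ts) ! j"

definition dest :: "'n::finite mode \<Rightarrow> 'n mode list \<Rightarrow> nat \<Rightarrow> 'n mode" where
  "dest p ps j = (p # ps @ [final_mode]) ! j"

definition switching_controls ::
  "(real ^ 'm::finite) set \<Rightarrow> real \<Rightarrow> 'n::finite mode \<Rightarrow> real \<Rightarrow> ('m, 'n) switching_control set" where
  "switching_controls A T p t =
     {(\<alpha>, m, ts, ps).
        \<alpha> \<in> controls A \<and> 1 \<le> m \<and> m \<le> CARD('n) - (\<Sum>i\<in>UNIV. of_bool (p $ i)) \<and>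
        length ts = m \<and> length ps = m - 1 \<and>
        (\<forall>j\<in>{1..m}. instant t ts (j - 1) \<le> instant t ts j) \<and> instant t ts m \<le> T \<and>
        (\<forall>j\<in>{1..m}. dest p ps j \<in> reachable (dest p ps (j - 1)))}"

definition switching_solution ::
  "('d::finite, 'm::finite, 'n::finite) dynamics \<Rightarrow> real ^ 'd \<Rightarrow> real \<Rightarrow> 'n mode
     \<Rightarrow> ('m, 'n) switching_control \<Rightarrow> (real \<Rightarrow> real ^ 'd) \<Rightarrow> bool" where
  "switching_solution f x t p u y \<longleftrightarrow>
     (case u of (\<alpha>, m, ts, ps) \<Rightarrow>
        abs_cont_on t (instant t ts m) y \<and> y t = x \<and>
        (\<forall>j\<in>{1..m}. AE s in lebesgue. s \<in> {instant t ts (j - 1)..instant t ts j} \<longrightarrow>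
           (y has_vector_derivative f (y s) (\<alpha> s) (dest p ps (j - 1))) (at s)))"

text \<open>
  The solution is determined only on the interval $[t, t_m]$. Its values elsewhere are arbitrary and
  do not enter the cost. The same applies to the trajectory of a stopping problem on $[t, T]$ below.
\<close>

definition switching_trajectory ::
  "('d::finite, 'm::finite, 'n::finite) dynamics \<Rightarrow> real ^ 'd \<Rightarrow> real \<Rightarrow> 'n mode
     \<Rightarrow> ('m, 'n) switching_control \<Rightarrow> real \<Rightarrow> real ^ 'd" where
  "switching_trajectory f x t p u = (SOME y. switching_solution f x t p u y)"

definition switching_J ::
  "('d::finite, 'm::finite, 'n::finite) dynamics \<Rightarrow> ('d, 'm, 'n) running_cost
     \<Rightarrow> ('d, 'n) switching_cost \<Rightarrow> real
     \<Rightarrow> real ^ 'd \<Rightarrow> real \<Rightarrow> 'n mode \<Rightarrow> ('m, 'n) switching_control \<Rightarrow> real" where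
  "switching_J f \<l> C lam x t p u =
     (case u of (\<alpha>, m, ts, ps) \<Rightarrow> let y = switching_trajectory f x t p u in
        \<Sum>j=1..m.
          (LINT s:{instant t ts (j - 1)..instant t ts j}|lebesgue.
             exp (- lam * (s - t)) * \<l> (y s) (\<alpha> s) (dest p ps (j - 1)) s)
          + exp (- lam * (instant t ts j - t))
            * C (y (instant t ts j)) (dest p ps (j - 1)) (dest p ps j))"

definition switching_value ::
  "('d::finite, 'm::finite, 'n::finite) dynamics \<Rightarrow> ('d, 'm, 'n) running_cost
     \<Rightarrow> ('d, 'n) switching_cost \<Rightarrow> (real ^ 'm) set \<Rightarrow> real \<Rightarrow> real
     \<Rightarrow> real ^ 'd \<Rightarrow> real \<Rightarrow> 'n mode \<Rightarrow> real" where
  "switching_value f \<l> C A lam T x t p =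
     (if p = final_mode then 0
      else INF u \<in> switching_controls A T p t. switching_J f \<l> C lam x t p u)"

definition stopping_solution ::
  "('d::finite, 'm::finite, 'n::finite) dynamics \<Rightarrow> real \<Rightarrow> real ^ 'd \<Rightarrow> real \<Rightarrow> 'n mode
     \<Rightarrow> 'm control \<Rightarrow> (real \<Rightarrow> real ^ 'd) \<Rightarrow> bool" where
  "stopping_solution f T x t p \<alpha> y \<longleftrightarrow>
     abs_cont_on t T y \<and> y t = x \<and>
     (AE s in lebesgue. s \<in> {t<..T} \<longrightarrow> (y has_vector_derivative f (y s) (\<alpha> s) p) (at s))"

definition stopping_trajectory ::
  "('d::finite, 'm::finite, 'n::finite) dynamics \<Rightarrow> real \<Rightarrow> real ^ 'd \<Rightarrow> real \<Rightarrow> 'n mode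
     \<Rightarrow> 'm control \<Rightarrow> real \<Rightarrow> real ^ 'd" where
  "stopping_trajectory f T x t p \<alpha> = (SOME y. stopping_solution f T x t p \<alpha> y)"

function stopping_value ::
  "('d::finite, 'm::finite, 'n::finite) dynamics \<Rightarrow> ('d, 'm, 'n) running_cost
     \<Rightarrow> ('d, 'n) switching_cost \<Rightarrow> (real ^ 'm) set \<Rightarrow> real \<Rightarrow> real
     \<Rightarrow> 'n mode \<Rightarrow> real ^ 'd \<Rightarrow> real \<Rightarrow> real" where
  "stopping_value f \<l> C A lam T p x t =
     (if p = final_mode then 0
      else INF (\<alpha>, \<tau>, p') \<in> controls A \<times> {t..T} \<times> reachable p.
        (let y = stopping_trajectory f T x t p \<alpha> in
           (LINT s:{t..\<tau>}|lebesgue. exp (- lam * (s - t)) * \<l> (y s) (\<alpha> s) p s)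
           + exp (- lam * (\<tau> - t))
             * (C (y \<tau>) p p' + stopping_value f \<l> C A lam T p' (y \<tau>) \<tau>)))"
  by pat_completeness auto
termination
proof (relation "Wellfounded.measure (\<lambda>(f, \<l>, C, A, lam, T, p, x, t). card {i. \<not> p $ i})", goal_cases)
  case 1
  then show ?case by simp
next
  case 2
  then show ?case by (auto simp: reachable_def intro!: psubset_card_mono)
qed

declare stopping_value.simps [simp del]

end

theory Submission
  imports Defs
begin

text \<open>
  Cut a switching control at its first switching instant \<open>\<tau>\<close>, and let \<open>q\<close> be its first destination. What
  happens before \<open>\<tau>\<close> is a strategy \<open>(\<alpha>, \<tau>, q)\<close> of the stopping problem for the initial mode. What happens
  afterwards is a switching control for the mode \<open>q\<close>, started at time \<open>\<tau>\<close> from the state reached there,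
  or nothing at all if \<open>q\<close> is the final mode. As the discount factors multiply, the cost of the whole is the
  cost of the first stage, in which the cost of the continuation enters as a terminal cost (\<open>J_step\<close>).
  Conversely a strategy \<open>(\<alpha>, \<tau>, q)\<close> and a continuation can be glued, because following one measurable
  control before \<open>\<tau>\<close> and another one from \<open>\<tau>\<close> on is a measurable control. So the infimum over all
  switching controls can be taken first over the continuations of a given first stage and then over the
  first stages. The inner infimum is the value function of the mode \<open>q\<close>; as it need not be attained,
  continuations that are optimal up to \<open>\<epsilon>\<close> are glued. This is the dynamic programming principle
  \<open>dynamic_programming_first_switch\<close>. It says that the value functions of the switching problem satisfy the
  recursion that defines those of the stopping problems. Each switch turns at least one zero of the mode
  into a one, so the two families agree by induction on the number of zeros.

  Both costs are evaluated along some chosen solution of the state equation. Cutting and gluing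
  therefore make sense only if solutions exist, since otherwise the chosen function is arbitrary, and if they
  are unique, so that the restriction of a chosen solution agrees with the solution chosen on the shorter
  interval. The controls are only measurable, so this is Caratheodory's theory: existence
  (\<open>caratheodory_exists\<close>) by Picard iteration of the integral equation, whose solutions satisfy the
  differential equation almost everywhere by Lebesgue's differentiation theorem, and uniqueness
  (\<open>caratheodory_unique\<close>) because an absolutely continuous function whose derivative is almost everywhere
  bounded by \<open>B\<close> moves with speed at most \<open>B\<close> (\<open>norm_increment_le\<close>).
\<close>

section \<open>Differentiation of indefinite integrals\<close>


text \<open>
  Lebesgue's differentiation theorem on the line. A covering argument, available as
  \<open>integrable_ccontinuous_explicit\<close>, gives the derivative from the right outside a null set; the derivative
  from the left is the one from the right of the reflected function.
\<close>

lemma has_vector_derivative_indefinite_integral_AE: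
  fixes g :: "real \<Rightarrow> 'a::euclidean_space"
  assumes g: "g integrable_on {a..b}"
  shows "AE s in lebesgue. s \<in> {a<..<b} \<longrightarrow>
           ((\<lambda>u. integral {a..u} g) has_vector_derivative g s) (at s)"
proof -
  \<comment> \<open>The covering argument needs a function that is integrable over every interval.\<close>
  define h where "h s = (if s \<in> {a..b} then g s else 0)" for s
  have hI: "h integrable_on cbox c d" for c d
  proof -
    have "h integrable_on UNIV"
      using g integrable_restrict_UNIV[of "{a..b}" g] by (simp add: h_def[abs_def])
    then show ?thesis by (rule integrable_on_subcbox) simp
  qed
  have kI: "(\<lambda>s. h (- s)) integrable_on cbox c d" for c d
    using integrable_reflect[where f = h and a = "- d" and b = "- c"] hI by simp
  obtain N1 where N1: "negligible N1" "\<And>x e. \<lbrakk>x \<notin> N1; 0 < e\<rbrakk> \<Longrightarrow>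
      \<exists>d>0. \<forall>r. 0 < r \<and> r < d \<longrightarrow> norm (integral {x..x + r} h /\<^sub>R r - h x) < e"
    using integrable_ccontinuous_explicit[OF hI] by (auto simp: )
  obtain N2 where N2: "negligible N2" "\<And>x e. \<lbrakk>x \<notin> N2; 0 < e\<rbrakk> \<Longrightarrow>
      \<exists>d>0. \<forall>r. 0 < r \<and> r < d \<longrightarrow> norm (integral {x..x + r} (\<lambda>s. h (- s)) /\<^sub>R r - h (- x)) < e"
    using integrable_ccontinuous_explicit[OF kI] by (auto simp: )
  have "negligible (uminus ` N2)"
    using N2(1) by (intro negligible_differentiable_image_negligible) (auto simp: differentiable_on_def intro: derivative_intros)
  then have N: "negligible (N1 \<union> uminus ` N2)"
    using N1(1) by simp
  have deriv: "((\<lambda>u. integral {a..u} g) has_vector_derivative g x) (at x)"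
    if x: "x \<notin> N1 \<union> uminus ` N2" "a < x" "x < b" for x
    unfolding has_vector_derivative_def has_derivative_at_alt
  proof (intro conjI allI impI)
    show "bounded_linear (\<lambda>r. r *\<^sub>R g x)" by (rule bounded_linear_scaleR_left)
    fix e :: real assume "e > 0"
    have hx: "h x = g x" using x by (simp add: h_def[abs_def])
    have "- x \<notin> N2" using x(1) by force
    from N2(2)[OF this \<open>e > 0\<close>] obtain d2 where d2: "d2 > 0"
      "\<And>r. 0 < r \<Longrightarrow> r < d2 \<Longrightarrow> norm (integral {-x..-x + r} (\<lambda>s. h (- s)) /\<^sub>R r - g x) < e"
      by (auto simp: hx)
    have "x \<notin> N1" using x by auto
    from N1(2)[OF this \<open>e > 0\<close>] obtain d1 where d1: "d1 > 0"
      "\<And>r. 0 < r \<Longrightarrow> r < d1 \<Longrightarrow> norm (integral {x..x + r} h /\<^sub>R r - g x) < e"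
      by (auto simp: hx)
    define d where "d = min (min d1 d2) (min (x - a) (b - x))"
    have scale: "norm (I - r *\<^sub>R v) \<le> e * r" if "norm (I /\<^sub>R r - v) < e" "r > 0" for I v :: 'a and r
    proof -
      have "I - r *\<^sub>R v = r *\<^sub>R (I /\<^sub>R r - v)" using that by (simp add: algebra_simps)
      then show ?thesis using that by (simp add: mult.commute)
    qed
    show "\<exists>d>0. \<forall>y. norm (y - x) < d \<longrightarrow>
       norm (integral {a..y} g - integral {a..x} g - (y - x) *\<^sub>R g x) \<le> e * norm (y - x)"
    proof (intro exI conjI allI impI)
      show "d > 0" using d1 d2 x by (simp add: d_def)
      fix y assume y: "norm (y - x) < d"
      then have yab: "a < y" "y < b" by (auto simp: d_def)
      have sub: "g integrable_on {a..u}" if "u \<le> b" for u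
        using integrable_on_subinterval[OF g] that by auto
      have intgh: "integral {u..v} h = integral {u..v} g" if "a \<le> u" "v \<le> b" for u v
        using that by (intro integral_cong) (auto simp: h_def)
      consider "y = x" | "y > x" | "y < x" by linarith
      then show "norm (integral {a..y} g - integral {a..x} g - (y - x) *\<^sub>R g x) \<le> e * norm (y - x)"
      proof cases
        case 1 then show ?thesis by simp
      next
        case 2
        have "integral {a..x} g + integral {x..y} g = integral {a..y} g"
          using 2 x yab by (intro Henstock_Kurzweil_Integration.integral_combine sub) auto
        then have "integral {a..y} g - integral {a..x} g = integral {x..x + (y - x)} h"
          using 2 x yab intgh[of x y] by (simp add: algebra_simps)
        moreover have "norm (integral {x..x + (y - x)} h - (y - x) *\<^sub>R g x) \<le> e * (y - x)"
          using 2 y by (intro scale d1(2)) (auto simp: d_def)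
        ultimately show ?thesis using 2 by simp
      next
        case 3
        have "integral {a..y} g + integral {y..x} g = integral {a..x} g"
          using 3 x yab by (intro Henstock_Kurzweil_Integration.integral_combine sub) auto
        moreover have "integral {-x..-x + (x - y)} (\<lambda>s. h (- s)) = integral {y..x} h"
          by simp
        ultimately have eq: "integral {a..y} g - integral {a..x} g
            = - integral {-x..-x + (x - y)} (\<lambda>s. h (- s))"
          using 3 x yab intgh[of y x] by (simp add: algebra_simps)
        have "norm (integral {-x..-x + (x - y)} (\<lambda>s. h (- s)) - (x - y) *\<^sub>R g x) \<le> e * (x - y)"
          using 3 y by (intro scale d2(2)) (auto simp: d_def)
        moreover have "- I - (y - x) *\<^sub>R v = - (I - (x - y) *\<^sub>R v)" for I v :: 'a
          by (simp add: algebra_simps)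
        ultimately show ?thesis using 3 by (simp only: eq norm_minus_cancel) simp
      qed
    qed
  qed
  show ?thesis
    using N deriv by (intro AE_I'[of "N1 \<union> uminus ` N2"]) (auto simp: negligible_iff_null_sets[symmetric])
qed

section \<open>Absolutely continuous functions\<close>

lemma abs_cont_on_subset:
  assumes "abs_cont_on a b y" "a \<le> c" "d \<le> b"
  shows "abs_cont_on c d y"
proof -
  have "{c..d} \<subseteq> {a..b}" using assms by auto
  then show ?thesis using assms(1) unfolding abs_cont_on_def by (meson order_trans)
qed

lemma abs_cont_on_diff:
  fixes y z :: "real \<Rightarrow> 'a::real_normed_vector"
  assumes "abs_cont_on a b y" "abs_cont_on a b z"
  shows "abs_cont_on a b (\<lambda>s. y s - z s)"
  unfolding abs_cont_on_def
proof (intro allI impI)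
  fix e :: real assume "e > 0"
  then have "e / 2 > 0" by simp
  from assms(1)[unfolded abs_cont_on_def, rule_format, OF this] obtain d1 where d1: "d1 > 0"
    "\<And>\<D> S. \<D> division_of S \<Longrightarrow> S \<subseteq> {a..b} \<Longrightarrow> (\<Sum>K\<in>\<D>. Sup K - Inf K) < d1
      \<Longrightarrow> (\<Sum>K\<in>\<D>. norm (y (Sup K) - y (Inf K))) < e / 2" by blast
  from assms(2)[unfolded abs_cont_on_def, rule_format, OF \<open>e / 2 > 0\<close>] obtain d2 where d2: "d2 > 0"
    "\<And>\<D> S. \<D> division_of S \<Longrightarrow> S \<subseteq> {a..b} \<Longrightarrow> (\<Sum>K\<in>\<D>. Sup K - Inf K) < d2
      \<Longrightarrow> (\<Sum>K\<in>\<D>. norm (z (Sup K) - z (Inf K))) < e / 2" by blast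
  show "\<exists>\<delta>>0. \<forall>\<D> S. \<D> division_of S \<and> S \<subseteq> {a..b} \<and> (\<Sum>K\<in>\<D>. Sup K - Inf K) < \<delta> \<longrightarrow>
     (\<Sum>K\<in>\<D>. norm (y (Sup K) - z (Sup K) - (y (Inf K) - z (Inf K)))) < e"
  proof (intro exI[of _ "min d1 d2"] conjI allI impI)
    show "0 < min d1 d2" using d1(1) d2(1) by simp
    fix \<D> S assume D: "\<D> division_of S \<and> S \<subseteq> {a..b} \<and> (\<Sum>K\<in>\<D>. Sup K - Inf K) < min d1 d2"
    have "(\<Sum>K\<in>\<D>. norm (y (Sup K) - z (Sup K) - (y (Inf K) - z (Inf K))))
        \<le> (\<Sum>K\<in>\<D>. norm (y (Sup K) - y (Inf K)) + norm (z (Sup K) - z (Inf K)))"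
    proof (rule sum_mono)
      fix K
      have "y (Sup K) - z (Sup K) - (y (Inf K) - z (Inf K))
          = (y (Sup K) - y (Inf K)) - (z (Sup K) - z (Inf K))" by (simp add: algebra_simps)
      then show "norm (y (Sup K) - z (Sup K) - (y (Inf K) - z (Inf K)))
          \<le> norm (y (Sup K) - y (Inf K)) + norm (z (Sup K) - z (Inf K))"
        by (metis norm_triangle_ineq4)
    qed
    also have "\<dots> < e / 2 + e / 2"
      unfolding sum.distrib using D d1(2)[of \<D> S] d2(2)[of \<D> S] by (intro add_strict_mono) auto
    finally show "(\<Sum>K\<in>\<D>. norm (y (Sup K) - z (Sup K) - (y (Inf K) - z (Inf K)))) < e" by simp
  qed
qed

lemma abs_cont_on_imp_continuous_on:
  fixes y :: "real \<Rightarrow> 'a::real_normed_vector"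
  assumes "abs_cont_on a b y"
  shows "continuous_on {a..b} y"
  unfolding continuous_on_iff
proof (intro ballI allI impI)
  fix u and e :: real assume u: "u \<in> {a..b}" and "e > 0"
  from assms[unfolded abs_cont_on_def, rule_format, OF this(2)] obtain d where d: "d > 0"
    "\<And>\<D> S. \<D> division_of S \<Longrightarrow> S \<subseteq> {a..b} \<Longrightarrow> (\<Sum>K\<in>\<D>. Sup K - Inf K) < d
      \<Longrightarrow> (\<Sum>K\<in>\<D>. norm (y (Sup K) - y (Inf K))) < e" by blast
  have small: "norm (y w - y v) < e" if "v \<le> w" "a \<le> v" "w \<le> b" "w - v < d" for v w
  proof -
    have "{{v..w}} division_of {v..w}"
      using that division_of_self[of v w] by simp
    from d(2)[OF this] show ?thesis using that by simp
  qed
  show "\<exists>d>0. \<forall>x'\<in>{a..b}. dist x' u < d \<longrightarrow> dist (y x') (y u) < e"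
  proof (intro exI[of _ d] conjI ballI impI d(1))
    fix v assume "v \<in> {a..b}" "dist v u < d"
    then show "dist (y v) (y u) < e"
      using small[of u v] small[of v u] u
      by (cases "u \<le> v") (auto simp: dist_norm norm_minus_commute abs_if split: if_splits)
  qed
qed

lemma lipschitz_imp_abs_cont_on:
  fixes y :: "real \<Rightarrow> 'a::real_normed_vector"
  assumes "M-lipschitz_on {a..b} y"
  shows "abs_cont_on a b y"
  unfolding abs_cont_on_def
proof (intro allI impI)
  fix e :: real assume "e > 0"
  have M: "M \<ge> 0" using assms lipschitz_on_nonneg by blast
  show "\<exists>\<delta>>0. \<forall>\<D> S. \<D> division_of S \<and> S \<subseteq> {a..b} \<and> (\<Sum>K\<in>\<D>. Sup K - Inf K) < \<delta> \<longrightarrow>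
     (\<Sum>K\<in>\<D>. norm (y (Sup K) - y (Inf K))) < e"
  proof (intro exI[of _ "e / (M + 1)"] conjI allI impI)
    show "0 < e / (M + 1)" using M \<open>e > 0\<close> by simp
    fix \<D> S assume D: "\<D> division_of S \<and> S \<subseteq> {a..b} \<and> (\<Sum>K\<in>\<D>. Sup K - Inf K) < e / (M + 1)"
    have K: "Sup K - Inf K \<ge> 0 \<and> norm (y (Sup K) - y (Inf K)) \<le> M * (Sup K - Inf K)" if "K \<in> \<D>" for K
    proof -
      obtain u v where uv: "K = {u..v}" "K \<noteq> {}" "K \<subseteq> {a..b}"
        using D \<open>K \<in> \<D>\<close> unfolding division_of_def by (metis cbox_interval order_trans)
      then show ?thesis using lipschitz_onD[OF assms, of v u] by (auto simp: dist_norm)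
    qed
    have "(\<Sum>K\<in>\<D>. norm (y (Sup K) - y (Inf K))) \<le> (\<Sum>K\<in>\<D>. M * (Sup K - Inf K))"
      using K by (intro sum_mono) auto
    also have "\<dots> = M * (\<Sum>K\<in>\<D>. Sup K - Inf K)" by (simp add: sum_distrib_left)
    also have "\<dots> \<le> (M + 1) * (\<Sum>K\<in>\<D>. Sup K - Inf K)"
      using K by (intro mult_right_mono sum_nonneg) auto
    also have "\<dots> < e" using D M by (simp add: field_simps)
    finally show "(\<Sum>K\<in>\<D>. norm (y (Sup K) - y (Inf K))) < e" .
  qed
qed

text \<open>
  The bound on the derivative controls increments only off a null set \<open>N\<close>; absolute continuity controls
  them on \<open>N\<close>. Cover \<open>N\<close> by an open set \<open>U\<close> of small measure and take a tagged division of the interval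
  that is so fine that the intervals with a tag in \<open>N\<close> lie in \<open>U\<close>, while over those with a tag \<open>s\<close>
  outside \<open>N\<close> the difference quotient is within \<open>e\<close> of the derivative at \<open>s\<close>. The former have small total length,
  so their total increment is less than \<open>e\<close>; the latter contribute at most \<open>(B + e) * (b - a)\<close>.
\<close>

lemma norm_increment_le:
  fixes y :: "real \<Rightarrow> 'a::real_normed_vector"
  assumes "a \<le> b" and ac: "abs_cont_on a b y" and "0 \<le> B"
    and deriv: "AE s in lebesgue. s \<in> {a..b} \<longrightarrow>
                  (\<exists>v. (y has_vector_derivative v) (at s) \<and> norm v \<le> B)"
  shows "norm (y b - y a) \<le> B * (b - a)"
proof -
  define N where "N = {s \<in> {a..b}. \<not> (\<exists>v. (y has_vector_derivative v) (at s) \<and> norm v \<le> B)}"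
  have "negligible N"
  proof -
    obtain Z where Z: "Z \<in> null_sets lebesgue"
      "{s \<in> space lebesgue. \<not> (s \<in> {a..b} \<longrightarrow> (\<exists>v. (y has_vector_derivative v) (at s) \<and> norm v \<le> B))} \<subseteq> Z"
      using deriv by (auto simp: eventually_ae_filter)
    then have "negligible Z" "N \<subseteq> Z" by (auto simp: negligible_iff_null_sets N_def)
    then show ?thesis by (rule negligible_subset)
  qed
  have "norm (y b - y a) \<le> B * (b - a) + e * (b - a + 1)" if "e > 0" for e
  proof -
    from ac[unfolded abs_cont_on_def, rule_format, OF that] obtain d where d: "d > 0"
      "\<And>\<D> S. \<D> division_of S \<Longrightarrow> S \<subseteq> {a..b} \<Longrightarrow> (\<Sum>K\<in>\<D>. Sup K - Inf K) < d
        \<Longrightarrow> (\<Sum>K\<in>\<D>. norm (y (Sup K) - y (Inf K))) < e" by blast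
    obtain U where U: "open U" "N \<subseteq> U" "U \<in> lmeasurable" "measure lebesgue U < d"
    proof -
      have "N \<in> null_sets lebesgue" using \<open>negligible N\<close> by (simp add: negligible_iff_null_sets)
      then have "N \<in> sets lebesgue" by auto
      from sets_lebesgue_outer_open[OF this d(1)] obtain U where U: "open U" "N \<subseteq> U"
        "U - N \<in> lmeasurable" "emeasure lebesgue (U - N) < ennreal d" by blast
      have "measure lebesgue (U - N) < d"
        using U(3,4) by (metis emeasure_eq_measure2 ennreal_leI linorder_not_le)
      moreover have "U \<in> sets lebesgue" using U(1) by simp
      ultimately have "measure lebesgue U < d"
        using \<open>N \<in> null_sets lebesgue\<close> by (simp add: measure_Diff_null_set)
      moreover have "U \<in> lmeasurable"
      proof -
        have "U = (U - N) \<union> N" using U(2) by auto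
        then show ?thesis
          using U(3) \<open>negligible N\<close> negligible_imp_measurable fmeasurable.Un by metis
      qed
      ultimately show thesis using that U by blast
    qed
    have "\<exists>r>0. \<forall>u v. u \<le> s \<longrightarrow> s \<le> v \<longrightarrow> u \<in> ball s r \<longrightarrow> v \<in> ball s r \<longrightarrow>
            norm (y v - y u) \<le> (B + e) * (v - u)" if s: "s \<in> {a..b} - N" for s
    proof -
      obtain w where w: "(y has_vector_derivative w) (at s)" "norm w \<le> B"
        using s by (auto simp: N_def)
      obtain r where r: "r > 0"
        "\<And>u. norm (u - s) < r \<Longrightarrow> norm (y u - y s - (u - s) *\<^sub>R w) \<le> e * norm (u - s)"
        using w(1) \<open>e > 0\<close> unfolding has_vector_derivative_def has_derivative_at_alt by blast
      show ?thesis
      proof (intro exI[of _ r] conjI allI impI r(1))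
        fix u v assume uv: "u \<le> s" "s \<le> v" "u \<in> ball s r" "v \<in> ball s r"
        have "norm (y v - y s - (v - s) *\<^sub>R w) \<le> e * (v - s)"
          using r(2)[of v] uv by (simp add: dist_real_def)
        moreover have "norm (y u - y s - (u - s) *\<^sub>R w) \<le> e * (s - u)"
          using r(2)[of u] uv by (simp add: dist_real_def)
        moreover have "norm ((v - u) *\<^sub>R w) \<le> (v - u) * B"
          using uv w(2) by (simp add: mult_left_mono)
        moreover have "y v - y u = (y v - y s - (v - s) *\<^sub>R w) - (y u - y s - (u - s) *\<^sub>R w) + (v - u) *\<^sub>R w"
          by (simp add: algebra_simps)
        moreover have "norm (p - q + k) \<le> norm p + norm q + norm k" for p q k :: 'a
          using norm_triangle_ineq[of "p - q" k] norm_triangle_ineq4[of p q] by linarith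
        ultimately have "norm (y v - y u) \<le> e * (v - s) + e * (s - u) + (v - u) * B"
          by (smt (verit, ccfv_threshold))
        then show "norm (y v - y u) \<le> (B + e) * (v - u)"
          by (simp add: algebra_simps)
      qed
    qed
    then obtain r where r: "\<And>s. s \<in> {a..b} - N \<Longrightarrow> r s > 0"
      "\<And>s u v. s \<in> {a..b} - N \<Longrightarrow> u \<le> s \<Longrightarrow> s \<le> v \<Longrightarrow> u \<in> ball s (r s) \<Longrightarrow> v \<in> ball s (r s) \<Longrightarrow>
            norm (y v - y u) \<le> (B + e) * (v - u)" by metis
    define \<gamma> where "\<gamma> s = (if s \<in> N then U else if s \<in> {a..b} then ball s (r s) else UNIV)" for s
    have "gauge \<gamma>" using U r(1) by (auto simp: gauge_def \<gamma>_def)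
    then obtain p where p: "p tagged_division_of {a..b}" "\<gamma> fine p"
      by (rule fine_division_exists_real)
    define P where "P = {xK \<in> p. fst xK \<in> N}"
    have finp: "finite p" using p(1) by blast
    have pD: "x \<in> {a..b} \<and> x \<in> K \<and> K \<subseteq> {a..b} \<and> K = {Inf K..Sup K} \<and> Inf K \<le> x \<and> x \<le> Sup K
              \<and> Inf K \<in> K \<and> Sup K \<in> K \<and> K \<subseteq> \<gamma> x"
      if "(x, K) \<in> p" for x K
    proof -
      obtain u v where "K = cbox u v" using p(1) \<open>(x, K) \<in> p\<close> by blast
      moreover have "x \<in> K" "K \<subseteq> {a..b}" using p(1) \<open>(x, K) \<in> p\<close> by blast+
      moreover have "K \<subseteq> \<gamma> x" using p(2) \<open>(x, K) \<in> p\<close> by (auto simp: fine_def)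
      ultimately show ?thesis by auto
    qed
    have pne: "K \<noteq> {}" if "(x, K) \<in> p" for x K using pD[OF that] by blast
    have P: "P tagged_partial_division_of {a..b}"
      using p(1) by (auto simp: P_def tagged_division_of_def intro: tagged_partial_division_subset)
    let ?\<D> = "snd ` P"
    have tagP: "P tagged_division_of \<Union>?\<D>"
      by (rule tagged_partial_division_of_Union_self[OF P])
    have div: "?\<D> division_of \<Union>?\<D>"
      by (rule division_of_tagged_division[OF tagP])
    have bad: "(\<Sum>(x,K)\<in>P. norm (y (Sup K) - y (Inf K))) < e"
    proof -
      \<comment> \<open>Passing from tagged intervals to intervals needs a summand that vanishes on every degenerate
        interval, also on the empty one, whose supremum and infimum are unspecified.\<close>
      let ?g = "\<lambda>K. if K = {} then 0 else norm (y (Sup K) - y (Inf K))"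
      have "(\<Sum>(x,K)\<in>P. norm (y (Sup K) - y (Inf K))) = (\<Sum>(x,K)\<in>P. ?g K)"
        using pne by (intro sum.cong) (auto simp: P_def)
      also have "\<dots> = (\<Sum>K\<in>?\<D>. ?g K)"
        by (rule sum.over_tagged_division_lemma[OF tagP]) (auto simp: box_eq_empty)
      also have "\<dots> = (\<Sum>K\<in>?\<D>. norm (y (Sup K) - y (Inf K)))"
        using pne by (intro sum.cong) (auto simp: P_def)
      also have "\<dots> < e"
      proof (rule d(2)[OF div])
        show "\<Union>?\<D> \<subseteq> {a..b}" using pD by (fastforce simp: P_def)
        have "(\<Sum>K\<in>?\<D>. Sup K - Inf K) = (\<Sum>K\<in>?\<D>. measure lebesgue K)"
        proof (rule sum.cong)
          fix K assume "K \<in> ?\<D>"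
          then obtain u v where "K = cbox u v" "cbox u v \<noteq> {}"
            using division_ofD(3,4)[OF div] by metis
          then show "Sup K - Inf K = measure lebesgue K" by simp
        qed simp
        also have "\<dots> = measure lebesgue (\<Union>?\<D>)"
        proof (rule measure_negligible_finite_Union[symmetric])
          show "finite ?\<D>" by (rule division_ofD(1)[OF div])
          show "K \<in> lmeasurable" if "K \<in> ?\<D>" for K
            using division_ofD(4)[OF div that] by auto
          show "pairwise (\<lambda>S T. negligible (S \<inter> T)) ?\<D>"
          proof (rule pairwiseI)
            fix S T assume ST: "S \<in> ?\<D>" "T \<in> ?\<D>" "S \<noteq> T"
            obtain u v u' v' where "S = cbox u v" "T = cbox u' v'"
              using division_ofD(4)[OF div ST(1)] division_ofD(4)[OF div ST(2)] by blast
            then obtain c d where cd: "S \<inter> T = cbox c d" by (simp only: Int_interval)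
            have "interior (cbox c d) = {}"
              using division_ofD(5)[OF div ST] by (simp only: cd[symmetric] interior_Int)
            then show "negligible (S \<inter> T)"
              unfolding cd by (simp only: interior_cbox negligible_interval)
          qed
        qed
        also have "\<dots> \<le> measure lebesgue U"
        proof (rule measure_mono_fmeasurable)
          show "\<Union>?\<D> \<subseteq> U"
          proof clarify
            fix s x K assume "s \<in> snd (x, K)" "(x, K) \<in> P"
            then show "s \<in> U" using pD[of x K] by (auto simp: P_def \<gamma>_def)
          qed
          have "K \<in> sets lebesgue" if "K \<in> ?\<D>" for K
            using division_ofD(4)[OF div that] by auto
          then show "\<Union>?\<D> \<in> sets lebesgue"
            by (intro sets.finite_Union division_ofD(1)[OF div]) blast
        qed fact
        finally show "(\<Sum>K\<in>?\<D>. Sup K - Inf K) < d" using U(4) by simp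
      qed
      finally show ?thesis .
    qed
    have good: "(\<Sum>(x,K)\<in>p - P. norm (y (Sup K) - y (Inf K))) \<le> (B + e) * (b - a)"
    proof -
      have "(\<Sum>(x,K)\<in>p - P. norm (y (Sup K) - y (Inf K))) \<le> (\<Sum>(x,K)\<in>p - P. (B + e) * (Sup K - Inf K))"
      proof (rule sum_mono, clarify)
        fix x K assume xK: "(x, K) \<in> p" "(x, K) \<notin> P"
        then have "x \<in> {a..b} - N" using pD[of x K] by (auto simp: P_def)
        moreover from this have "Inf K \<in> ball x (r x)" "Sup K \<in> ball x (r x)"
          using pD[OF xK(1)] by (auto simp: \<gamma>_def subset_iff simp del: mem_ball)
        ultimately show "norm (y (Sup K) - y (Inf K)) \<le> (B + e) * (Sup K - Inf K)"
          using pD[OF xK(1)] r(2) by blast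
      qed
      also have "\<dots> \<le> (\<Sum>(x,K)\<in>p. (B + e) * (Sup K - Inf K))"
      proof (rule sum_mono2[OF finp])
        fix xK assume "xK \<in> p - (p - P)"
        then show "0 \<le> (case xK of (x, K) \<Rightarrow> (B + e) * (Sup K - Inf K))"
          using pD[of "fst xK" "snd xK"] \<open>0 \<le> B\<close> \<open>e > 0\<close> by (auto simp: split_def)
      qed auto
      also have "\<dots> = (B + e) * (\<Sum>(x,K)\<in>p. Sup K - Inf K)"
        by (simp add: sum_distrib_left split_def)
      also have "(\<Sum>(x,K)\<in>p. Sup K - Inf K) = b - a"
        using additive_tagged_division_1[OF \<open>a \<le> b\<close> p(1), of "\<lambda>x. x"] by simp
      finally show ?thesis .
    qed
    have "y b - y a = (\<Sum>(x,K)\<in>p. y (Sup K) - y (Inf K))"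
      using additive_tagged_division_1[OF \<open>a \<le> b\<close> p(1), of y] by simp
    then have "norm (y b - y a) \<le> (\<Sum>(x,K)\<in>p. norm (y (Sup K) - y (Inf K)))"
      by (simp add: split_def norm_sum)
    also have "\<dots> = (\<Sum>(x,K)\<in>p - P. norm (y (Sup K) - y (Inf K))) + (\<Sum>(x,K)\<in>P. norm (y (Sup K) - y (Inf K)))"
      by (rule sum.subset_diff) (auto simp: P_def finp)
    finally show ?thesis using good bad by (simp add: algebra_simps)
  qed
  then have step: "norm (y b - y a) \<le> B * (b - a) + e * (b - a + 1)" if "e > 0" for e
    using that by blast
  show ?thesis
  proof (rule field_le_epsilon)
    fix e :: real assume "e > 0"
    then show "norm (y b - y a) \<le> B * (b - a) + e"
      using step[of "e / (b - a + 1)"] \<open>a \<le> b\<close> by simp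
  qed
qed

section \<open>The Caratheodory initial value problem\<close>

definition caratheodory_solution ::
  "(real \<Rightarrow> 'a::real_normed_vector \<Rightarrow> 'a) \<Rightarrow> real \<Rightarrow> real \<Rightarrow> 'a \<Rightarrow> (real \<Rightarrow> 'a) \<Rightarrow> bool" where
  "caratheodory_solution g a b x y \<longleftrightarrow> abs_cont_on a b y \<and> y a = x \<and>
     (AE s in lebesgue. s \<in> {a..b} \<longrightarrow> (y has_vector_derivative g s (y s)) (at s))"

text \<open>
  On an interval of length \<open>1 / (2 * L)\<close> at whose left end two solutions agree, their difference moves with
  speed at most \<open>L * R\<close>, where \<open>R\<close> is its maximal norm there. Hence \<open>R \<le> R / 2\<close>, which forces \<open>R = 0\<close>.
  Such intervals are chained.
\<close>

lemma caratheodory_unique: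
  fixes y1 y2 :: "real \<Rightarrow> 'a::real_normed_vector"
  assumes y1: "caratheodory_solution g a b x y1" and y2: "caratheodory_solution g a b x y2"
    and lip: "\<And>s z w. s \<in> {a..b} \<Longrightarrow> norm (g s z - g s w) \<le> L * norm (z - w)" and "0 < L"
    and "s \<in> {a..b}"
  shows "y1 s = y2 s"
proof -
  define z where "z r = y1 r - y2 r" for r
  have z: "abs_cont_on a b z" "z a = 0"
    using y1 y2 by (auto simp: caratheodory_solution_def z_def[abs_def] intro: abs_cont_on_diff)
  have dz: "AE r in lebesgue. r \<in> {a..b} \<longrightarrow>
      (\<exists>v. (z has_vector_derivative v) (at r) \<and> norm v \<le> L * norm (z r))"
  proof -
    have "AE r in lebesgue. r \<in> {a..b} \<longrightarrow> (y1 has_vector_derivative g r (y1 r)) (at r)"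
      "AE r in lebesgue. r \<in> {a..b} \<longrightarrow> (y2 has_vector_derivative g r (y2 r)) (at r)"
      using y1 y2 by (auto simp: caratheodory_solution_def)
    then show ?thesis
    proof eventually_elim
      case (elim r)
      then show ?case using lip[of r "y1 r" "y2 r"]
        unfolding z_def[abs_def] by (blast intro: has_vector_derivative_diff)
    qed
  qed
  have step: "\<forall>r\<in>{c..d}. z r = 0"
    if "a \<le> c" "d \<le> b" "d \<le> c + 1 / (2 * L)" "z c = 0" for c d
  proof (cases "c \<le> d")
    case True
    have "continuous_on {c..d} (\<lambda>r. norm (z r))"
      using abs_cont_on_imp_continuous_on[OF abs_cont_on_subset[OF z(1)]] that
      by (intro continuous_on_norm) auto
    with True obtain m where m: "m \<in> {c..d}" "\<And>r. r \<in> {c..d} \<Longrightarrow> norm (z r) \<le> norm (z m)"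
      using continuous_attains_sup[of "{c..d}" "\<lambda>r. norm (z r)"] by auto
    have "norm (z m - z c) \<le> (L * norm (z m)) * (m - c)"
    proof (rule norm_increment_le)
      show "abs_cont_on c m z" using z(1) m(1) that by (auto intro: abs_cont_on_subset)
      show "AE r in lebesgue. r \<in> {c..m} \<longrightarrow>
          (\<exists>v. (z has_vector_derivative v) (at r) \<and> norm v \<le> L * norm (z m))"
        using dz
      proof eventually_elim
        case (elim r)
        show ?case
        proof
          assume r: "r \<in> {c..m}"
          with elim m(1) that obtain v where v: "(z has_vector_derivative v) (at r)" "norm v \<le> L * norm (z r)"
            by auto
          moreover have "L * norm (z r) \<le> L * norm (z m)"
            using m(2)[of r] r m(1) \<open>0 < L\<close> by (intro mult_left_mono) auto
          ultimately show "\<exists>v. (z has_vector_derivative v) (at r) \<and> norm v \<le> L * norm (z m)"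
            by (meson order_trans)
        qed
      qed
    qed (use m(1) \<open>0 < L\<close> in auto)
    also have "\<dots> \<le> (L * norm (z m)) * (1 / (2 * L))"
      using m(1) that \<open>0 < L\<close> by (intro mult_left_mono) auto
    also have "\<dots> = norm (z m) / 2" using \<open>0 < L\<close> by simp
    finally have "norm (z m) \<le> 0" using that(4) by simp
    then show ?thesis using m(2) by fastforce
  qed simp
  have "\<forall>r\<in>{a..min b (a + real n / (2 * L))}. z r = 0" for n
  proof (induction n)
    case 0
    then show ?case using z(2) by auto
  next
    case (Suc n)
    show ?case
    proof
      fix r assume r: "r \<in> {a..min b (a + real (Suc n) / (2 * L))}"
      let ?c = "a + real n / (2 * L)"
      show "z r = 0"
      proof (cases "r \<le> ?c")
        case True
        then show ?thesis using Suc r by auto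
      next
        case False
        then have "z ?c = 0" using Suc r \<open>0 < L\<close> by auto
        then show ?thesis
          using step[of ?c r] r False \<open>0 < L\<close> by (auto simp: field_simps)
      qed
    qed
  qed
  moreover obtain n where "(s - a) * (2 * L) \<le> real n" using real_arch_simple by blast
  ultimately have "z s = 0"
    using \<open>s \<in> {a..b}\<close> \<open>0 < L\<close> by (auto simp: field_simps)
  then show ?thesis by (simp add: z_def)
qed

lemma AE_lebesgue_not_in_finite:
  "finite F \<Longrightarrow> AE s in lebesgue. s \<notin> F"
  for F :: "real set"
  by (rule AE_not_in) (simp add: negligible_iff_null_sets[symmetric] negligible_finite)

text \<open>
  Picard iteration of the integral equation. Measured with the weight \<open>exp (- 2 * L * (s - a))\<close> the integral
  operator \<open>P\<close> is a contraction with factor \<open>1 / 2\<close>, so the iterates converge uniformly on the whole interval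
  and not only on a short one. The values of \<open>P\<close> are Lipschitz, which is recorded for the solution
  because, unlike absolute continuity, it passes easily to concatenations.
\<close>

lemma caratheodory_exists:
  fixes g :: "real \<Rightarrow> 'a::euclidean_space \<Rightarrow> 'a"
  assumes "a \<le> b"
    and meas: "\<And>y. continuous_on {a..b} y \<Longrightarrow> (\<lambda>s. g s (y s)) \<in> borel_measurable (lebesgue_on {a..b})"
    and bound: "\<And>s z. s \<in> {a..b} \<Longrightarrow> norm (g s z) \<le> M"
    and lip: "\<And>s z w. s \<in> {a..b} \<Longrightarrow> norm (g s z - g s w) \<le> L * norm (z - w)" and "0 < L"
  obtains y where "caratheodory_solution g a b x y" "M-lipschitz_on {a..b} y"
proof -
  have "0 \<le> norm (g a x)" by simp
  also have "\<dots> \<le> M" using bound[of a x] \<open>a \<le> b\<close> by simp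
  finally have "0 \<le> M" .
  have int: "(\<lambda>r. g r (y r)) integrable_on {u..v}"
    if y: "continuous_on {a..b} y" and "a \<le> u" "v \<le> b" for y u v
  proof -
    have "(\<lambda>r. g r (y r)) integrable_on {a..b}"
      by (rule measurable_bounded_by_integrable_imp_integrable[OF meas[OF y], of "\<lambda>_. M"])
        (auto intro: bound)
    then show ?thesis by (rule integrable_on_subinterval) (use that in auto)
  qed
  define P where "P y s = x + integral {a..s} (\<lambda>r. g r (y r))" for y s
  have P_lip: "M-lipschitz_on {a..b} (P y)" if y: "continuous_on {a..b} y" for y
  proof -
    have *: "norm (P y v - P y u) \<le> M * (v - u)" if "a \<le> u" "u \<le> v" "v \<le> b" for u v
    proof -
      have "integral {a..u} (\<lambda>r. g r (y r)) + integral {u..v} (\<lambda>r. g r (y r)) = integral {a..v} (\<lambda>r. g r (y r))"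
        using that by (intro Henstock_Kurzweil_Integration.integral_combine int y) auto
      then have "P y v - P y u = integral {u..v} (\<lambda>r. g r (y r))"
        by (simp add: P_def algebra_simps)
      also have "norm \<dots> \<le> integral {u..v} (\<lambda>_. M)"
        using that by (intro Henstock_Kurzweil_Integration.integral_norm_bound_integral int y bound) auto
      also have "\<dots> = M * (v - u)" using that by simp
      finally show ?thesis .
    qed
    show ?thesis
    proof (rule lipschitz_onI[OF _ \<open>0 \<le> M\<close>])
      fix u v assume "u \<in> {a..b}" "v \<in> {a..b}"
      then show "dist (P y u) (P y v) \<le> M * dist u v"
        using *[of u v] *[of v u] by (cases "u \<le> v") (auto simp: dist_norm norm_minus_commute)
    qed
  qed
  have P_diff: "norm (P u s - P v s) \<le> integral {a..s} h"
    if "continuous_on {a..b} u" "continuous_on {a..b} v" "s \<in> {a..b}" "h integrable_on {a..s}"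
      "\<And>r. r \<in> {a..s} \<Longrightarrow> L * norm (u r - v r) \<le> h r" for u v s h
  proof -
    have "P u s - P v s = integral {a..s} (\<lambda>r. g r (u r) - g r (v r))"
      using that unfolding P_def by (subst Henstock_Kurzweil_Integration.integral_diff) (auto intro: int)
    also have "norm \<dots> \<le> integral {a..s} h"
    proof (rule Henstock_Kurzweil_Integration.integral_norm_bound_integral)
      show "(\<lambda>r. g r (u r) - g r (v r)) integrable_on {a..s}"
        using that by (intro Henstock_Kurzweil_Integration.integrable_diff int) auto
      fix r assume "r \<in> {a..s}"
      then show "norm (g r (u r) - g r (v r)) \<le> h r"
        using lip[of r "u r" "v r"] that(3) that(5)[of r] by auto
    qed fact
    finally show ?thesis .
  qed
  define yy where "yy n = (P ^^ n) (\<lambda>_. x)" for n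
  have yy_Suc: "yy (Suc n) = P (yy n)" for n by (simp add: yy_def)
  have yy_cont: "continuous_on {a..b} (yy n)" for n
  proof (induction n)
    case 0 show ?case by (simp add: yy_def)
  next
    case (Suc n) show ?case
      unfolding yy_Suc by (rule lipschitz_on_continuous_on[OF P_lip[OF Suc]])
  qed
  define K where "K = M * (b - a)"
  have "0 \<le> K" using \<open>0 \<le> M\<close> \<open>a \<le> b\<close> by (simp add: K_def)
  have yy_step: "norm (yy (Suc n) s - yy n s) \<le> K * (1/2)^n * exp (2 * L * (s - a))" if "s \<in> {a..b}" for n s
    using that
  proof (induction n arbitrary: s)
    case 0
    have "norm (yy (Suc 0) s - yy 0 s) = dist (P (yy 0) s) (P (yy 0) a)"
      by (simp add: yy_def P_def dist_norm)
    also have "\<dots> \<le> M * dist s a"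
      using 0 \<open>a \<le> b\<close> by (intro lipschitz_onD[OF P_lip[OF yy_cont]]) auto
    also have "\<dots> \<le> K" using 0 \<open>0 \<le> M\<close> by (auto simp: K_def dist_real_def intro: mult_left_mono)
    also have "\<dots> \<le> K * exp (2 * L * (s - a))"
      using 0 \<open>0 < L\<close> \<open>0 \<le> K\<close> by (simp add: mult_le_cancel_left1)
    finally show ?case by simp
  next
    case (Suc n)
    define c where "c = K * (1/2)^n"
    have "((\<lambda>r. L * (c * exp (2 * L * (r - a)))) has_integral
             (c / 2 * exp (2 * L * (s - a)) - c / 2 * exp (2 * L * (a - a)))) {a..s}"
      using Suc.prems by (intro fundamental_theorem_of_calculus)
        (auto intro!: derivative_eq_intros simp: has_real_derivative_iff_has_vector_derivative[symmetric])
    then have I: "(\<lambda>r. L * (c * exp (2 * L * (r - a)))) integrable_on {a..s}"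
      "integral {a..s} (\<lambda>r. L * (c * exp (2 * L * (r - a)))) = c / 2 * exp (2 * L * (s - a)) - c / 2"
      by (auto simp: has_integral_iff)
    have "norm (yy (Suc (Suc n)) s - yy (Suc n) s) = norm (P (yy (Suc n)) s - P (yy n) s)"
      by (simp add: yy_Suc)
    also have "\<dots> \<le> integral {a..s} (\<lambda>r. L * (c * exp (2 * L * (r - a))))"
    proof (intro P_diff yy_cont I Suc.prems)
      fix r assume "r \<in> {a..s}"
      then show "L * norm (yy (Suc n) r - yy n r) \<le> L * (c * exp (2 * L * (r - a)))"
        using Suc.IH[of r] Suc.prems \<open>0 < L\<close> unfolding c_def by (intro mult_left_mono) auto
    qed
    also have "\<dots> \<le> c / 2 * exp (2 * L * (s - a))"
      unfolding I using \<open>0 \<le> K\<close> by (simp add: c_def)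
    also have "\<dots> = K * (1/2)^Suc n * exp (2 * L * (s - a))" by (simp add: c_def)
    finally show ?case .
  qed
  define y where "y s = x + (\<Sum>n. yy (Suc n) s - yy n s)" for s
  have "uniform_limit {a..b} (\<lambda>n s. \<Sum>i<n. yy (Suc i) s - yy i s) (\<lambda>s. \<Sum>n. yy (Suc n) s - yy n s) sequentially"
  proof (rule Weierstrass_m_test)
    show "summable (\<lambda>n. K * exp (2 * L * (b - a)) * (1/2)^n)"
      by (intro summable_mult summable_geometric) simp
    fix n s assume s: "s \<in> {a..b}"
    have "K * (1/2)^n * exp (2 * L * (s - a)) \<le> K * (1/2)^n * exp (2 * L * (b - a))"
      using s \<open>0 \<le> K\<close> \<open>0 < L\<close> by (intro mult_left_mono) auto
    then show "norm (yy (Suc n) s - yy n s) \<le> K * exp (2 * L * (b - a)) * (1/2)^n"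
      using yy_step[OF s, of n] by (simp add: mult_ac)
  qed
  moreover have "(\<Sum>i<n. yy (Suc i) s - yy i s) = yy n s - x" for n s
    using sum_lessThan_telescope[of "\<lambda>i. yy i s" n] by (simp add: yy_def)
  ultimately have "uniform_limit {a..b} (\<lambda>n s. yy n s - x) (\<lambda>s. \<Sum>n. yy (Suc n) s - yy n s) sequentially"
    by simp
  then have lim: "uniform_limit {a..b} yy y sequentially"
    by (simp add: uniform_limit_iff y_def dist_norm algebra_simps)
  have y_cont: "continuous_on {a..b} y"
    by (rule uniform_limit_theorem[OF _ lim]) (simp_all add: yy_cont)
  have fixpoint: "y s = P y s" if s: "s \<in> {a..b}" for s
  proof -
    have "norm (y s - P y s) \<le> 0 + e" if "e > 0" for e
    proof -
      define \<epsilon> where "\<epsilon> = e / (1 + L * (b - a))"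
      have "\<epsilon> > 0" using \<open>0 < L\<close> \<open>a \<le> b\<close> that by (simp add: \<epsilon>_def add_pos_nonneg)
      with lim obtain n where n: "\<And>m r. m \<ge> n \<Longrightarrow> r \<in> {a..b} \<Longrightarrow> norm (yy m r - y r) < \<epsilon>"
        unfolding uniform_limit_iff eventually_sequentially dist_norm by blast
      have "norm (P (yy n) s - P y s) \<le> integral {a..s} (\<lambda>_. L * \<epsilon>)"
        using s n[of n] \<open>0 < L\<close> by (intro P_diff yy_cont y_cont) (auto intro!: mult_left_mono less_imp_le)
      also have "\<dots> = L * \<epsilon> * (s - a)" using s by simp
      also have "\<dots> \<le> L * \<epsilon> * (b - a)" using s \<open>0 < L\<close> \<open>\<epsilon> > 0\<close> by (intro mult_left_mono) auto
      finally have "norm (yy (Suc n) s - P y s) \<le> L * \<epsilon> * (b - a)" by (simp add: yy_Suc)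
      moreover have "norm (yy (Suc n) s - y s) < \<epsilon>" using n[of "Suc n" s] s by simp
      ultimately have "norm (y s - P y s) \<le> \<epsilon> + L * \<epsilon> * (b - a)"
        using norm_triangle_ineq4[of "yy (Suc n) s - P y s" "yy (Suc n) s - y s"] by simp
      also have "\<dots> = \<epsilon> * (1 + L * (b - a))" by (simp add: algebra_simps)
      also have "\<dots> = e"
        using \<open>0 < L\<close> \<open>a \<le> b\<close> by (simp add: \<epsilon>_def) (metis add_pos_nonneg diff_ge_0_iff_ge less_irrefl mult_nonneg_nonneg order_less_imp_le zero_less_one)
      finally show ?thesis by simp
    qed
    then have "norm (y s - P y s) \<le> 0" by (rule field_le_epsilon)
    then show ?thesis by simp
  qed
  \<comment> \<open>The solution returned is \<open>P y\<close>: it agrees with \<open>y\<close> on the interval, and it is an indefinite integral by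
    definition, so that its derivative need not be transferred to \<open>y\<close>.\<close>
  have "AE s in lebesgue. s \<in> {a<..<b} \<longrightarrow>
      ((\<lambda>u. integral {a..u} (\<lambda>r. g r (y r))) has_vector_derivative g s (y s)) (at s)"
    using int[OF y_cont, of a b] by (intro has_vector_derivative_indefinite_integral_AE) simp
  moreover have "AE s in lebesgue. s \<notin> {a, b}"
    by (rule AE_lebesgue_not_in_finite) simp
  ultimately have "AE s in lebesgue. s \<in> {a..b} \<longrightarrow> (P y has_vector_derivative g s (P y s)) (at s)"
  proof eventually_elim
    case (elim s)
    show ?case
    proof
      assume "s \<in> {a..b}"
      then show "(P y has_vector_derivative g s (P y s)) (at s)"
        using elim fixpoint[of s] unfolding P_def[abs_def]
        by (auto intro!: derivative_eq_intros)
    qed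
  qed
  then have "caratheodory_solution g a b x (P y)"
    using lipschitz_imp_abs_cont_on[OF P_lip[OF y_cont]]
    by (simp add: caratheodory_solution_def P_def)
  then show thesis using P_lip[OF y_cont] that by blast
qed

lemma caratheodory_solution_subinterval:
  assumes "caratheodory_solution g a b x y" "a \<le> c" "d \<le> b"
  shows "caratheodory_solution g c d (y c) y"
proof -
  have "AE s in lebesgue. s \<in> {a..b} \<longrightarrow> (y has_vector_derivative g s (y s)) (at s)"
    using assms by (simp add: caratheodory_solution_def)
  then have "AE s in lebesgue. s \<in> {c..d} \<longrightarrow> (y has_vector_derivative g s (y s)) (at s)"
    by eventually_elim (use assms in auto)
  then show ?thesis
    using assms by (auto simp: caratheodory_solution_def intro: abs_cont_on_subset)
qed

text \<open>
  Needed for glued controls, which agree with the first control before the switching instant but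
  not at it.
\<close>

lemma caratheodory_solution_change_endpoint:
  assumes "caratheodory_solution g a b x y" "\<And>s z. s \<in> {a..<b} \<Longrightarrow> g s z = g' s z"
  shows "caratheodory_solution g' a b x y"
proof -
  have "AE s in lebesgue. s \<in> {a..b} \<longrightarrow> (y has_vector_derivative g s (y s)) (at s)"
    using assms by (simp add: caratheodory_solution_def)
  moreover have "AE s in lebesgue. s \<notin> {b}" by (rule AE_lebesgue_not_in_finite) simp
  ultimately have "AE s in lebesgue. s \<in> {a..b} \<longrightarrow> (y has_vector_derivative g' s (y s)) (at s)"
    by eventually_elim (use assms(2) in auto)
  then show ?thesis using assms(1) by (simp add: caratheodory_solution_def)
qed

lemma stopping_solution_iff_caratheodory:
  "stopping_solution f T x t p \<alpha> y \<longleftrightarrow> caratheodory_solution (\<lambda>s z. f z (\<alpha> s) p) t T x y"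
proof -
  have t: "AE s in lebesgue. s \<notin> {t}" by (rule AE_lebesgue_not_in_finite) simp
  have "(AE s in lebesgue. s \<in> {t<..T} \<longrightarrow> (y has_vector_derivative f (y s) (\<alpha> s) p) (at s))
      \<longleftrightarrow> (AE s in lebesgue. s \<in> {t..T} \<longrightarrow> (y has_vector_derivative f (y s) (\<alpha> s) p) (at s))"
    by (rule eventually_cong[OF t]) auto
  then show ?thesis by (simp add: stopping_solution_def caratheodory_solution_def)
qed

section \<open>Schedules of switches\<close>

text \<open>
  The indexed constraints on switching instants and destinations, arranged so that the first switch comes
  off the front: a schedule is either a last switch, to the final mode, or a switch to \<open>q\<close> followed
  by a schedule for \<open>q\<close>.
\<close>

inductive schedule :: "real \<Rightarrow> 'n::finite mode \<Rightarrow> real \<Rightarrow> real list \<Rightarrow> 'n mode list \<Rightarrow> bool" for T where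
  last: "t \<le> \<tau> \<Longrightarrow> \<tau> \<le> T \<Longrightarrow> final_mode \<in> reachable p \<Longrightarrow> schedule T p t [\<tau>] []"
| step: "t \<le> \<tau> \<Longrightarrow> q \<in> reachable p \<Longrightarrow> schedule T q \<tau> ts ps \<Longrightarrow> schedule T p t (\<tau> # ts) (q # ps)"

lemma instant_simps [simp]:
  "instant t ts 0 = t"
  "instant t (\<tau> # ts) (Suc j) = instant \<tau> ts j"
  by (simp_all add: instant_def)

lemma dest_simps [simp]:
  "dest p ps 0 = p"
  "dest p [] (Suc 0) = final_mode"
  "dest p (q # ps) (Suc j) = dest q ps j"
  by (simp_all add: dest_def)

lemma ball_stages_iff:
  "(\<forall>j\<in>{1..m}. P (j - 1) j) \<longleftrightarrow> (\<forall>j<m. P j (Suc j))"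
proof
  assume "\<forall>j\<in>{1..m}. P (j - 1) j"
  then show "\<forall>j<m. P j (Suc j)" by (auto dest!: bspec[of _ _ "Suc _"])
next
  assume *: "\<forall>j<m. P j (Suc j)"
  show "\<forall>j\<in>{1..m}. P (j - 1) j"
  proof
    fix j assume "j \<in> {1..m}"
    then show "P (j - 1) j" using * by (cases j) auto
  qed
qed

definition zeros :: "'n::finite mode \<Rightarrow> nat" where
  "zeros p = card {i. \<not> p $ i}"

lemma zeros_reachable: "q \<in> reachable p \<Longrightarrow> zeros q < zeros p"
  unfolding zeros_def by (rule psubset_card_mono) (auto simp: reachable_def)

lemma zeros_eq: "CARD('n) - (\<Sum>i\<in>UNIV. of_bool (p $ i)) = zeros (p :: 'n::finite mode)"
proof -
  have "(\<Sum>i\<in>UNIV. of_bool (p $ i)) = card {i. p $ i}"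
    by (simp add: of_bool_def sum.If_cases)
  moreover have "CARD('n) = card {i. p $ i} + zeros p"
    unfolding zeros_def by (subst card_Un_disjoint[symmetric]) (auto intro: arg_cong[where f = card])
  ultimately show ?thesis by simp
qed

lemma final_mode_in_reachable: "p \<noteq> final_mode \<longleftrightarrow> final_mode \<in> reachable p"
  by (auto simp: reachable_def final_mode_def vec_eq_iff)

lemma reachable_final_mode [simp]: "reachable final_mode = {}"
  by (auto simp: reachable_def final_mode_def)

lemma schedule_not_final: "schedule T p t ts ps \<Longrightarrow> p \<noteq> final_mode"
  by (auto elim: schedule.cases)

text \<open>
  Every switch removes a zero of the mode. So a schedule for \<open>p\<close> has at most \<open>zeros p\<close> switches, which is the
  bound on \<open>m\<close> in the definition of switching controls.
\<close>

lemma schedule_iff: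
  "schedule T p t ts ps \<longleftrightarrow>
     1 \<le> length ts \<and> length ts \<le> zeros p \<and> length ps = length ts - 1 \<and>
     (\<forall>j<length ts. instant t ts j \<le> instant t ts (Suc j)) \<and> instant t ts (length ts) \<le> T \<and>
     (\<forall>j<length ts. dest p ps (Suc j) \<in> reachable (dest p ps j))"
  (is "_ \<longleftrightarrow> ?valid p t ts ps")
proof
  show "schedule T p t ts ps \<Longrightarrow> ?valid p t ts ps"
  proof (induction rule: schedule.induct)
    case (last t \<tau> p)
    then show ?case using zeros_reachable[of final_mode p] by auto
  next
    case (step t \<tau> q p ts ps)
    then show ?case using zeros_reachable[OF step.hyps(2)] by (auto simp: All_less_Suc2)
  qed
next
  have "schedule T p t ts ps"
    if "1 \<le> length ts" "length ps = length ts - 1" "\<forall>j<length ts. instant t ts j \<le> instant t ts (Suc j)"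
      "instant t ts (length ts) \<le> T" "\<forall>j<length ts. dest p ps (Suc j) \<in> reachable (dest p ps j)"
    using that
  proof (induction ts arbitrary: p t ps)
    case Nil
    then show ?case by simp
  next
    case (Cons \<tau> ts)
    show ?case
    proof (cases ps)
      case Nil
      then show ?thesis using Cons.prems by (auto intro: schedule.last)
    next
      case (Cons q qs)
      have "schedule T q \<tau> ts qs"
        using Cons.prems Cons by (intro Cons.IH) (auto simp: All_less_Suc2)
      then show ?thesis using Cons.prems Cons by (auto simp: All_less_Suc2 intro: schedule.step)
    qed
  qed
  then show "?valid p t ts ps \<Longrightarrow> schedule T p t ts ps" by blast
qed

lemma switching_controls_eq_schedules:
  "switching_controls A T p t =
     {(\<alpha>, m, ts, ps). \<alpha> \<in> controls A \<and> m = length ts \<and> schedule T p t ts ps}"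
  unfolding switching_controls_def zeros_eq schedule_iff
    ball_stages_iff[of _ "\<lambda>i j. instant _ _ i \<le> instant _ _ j"]
    ball_stages_iff[of _ "\<lambda>i j. dest _ _ j \<in> reachable (dest _ _ i)"]
  by auto

lemma schedule_instants:
  assumes "schedule T p t ts ps" "j \<le> length ts"
  shows "t \<le> instant t ts j" "instant t ts j \<le> T" "instant t ts j \<le> instant t ts (length ts)"
proof -
  have "t \<le> instant t ts j \<and> instant t ts j \<le> instant t ts (length ts) \<and> instant t ts (length ts) \<le> T"
    using assms
  proof (induction arbitrary: j rule: schedule.induct)
    case (last t \<tau> p)
    then show ?case by (cases j) auto
  next
    case (step t \<tau> q p ts ps)
    have "t \<le> instant \<tau> ts i" if "i \<le> length ts" for i
      using step.IH[OF that] step.hyps(1) by simp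
    then show ?case using step.IH step.prems by (cases j) auto
  qed
  then show "t \<le> instant t ts j" "instant t ts j \<le> T" "instant t ts j \<le> instant t ts (length ts)" by auto
qed

lemma switching_solution_iff:
  "switching_solution f x t p (\<alpha>, m, ts, ps) y \<longleftrightarrow>
     abs_cont_on t (instant t ts m) y \<and> y t = x \<and>
     (\<forall>j<m. AE s in lebesgue. s \<in> {instant t ts j..instant t ts (Suc j)} \<longrightarrow>
        (y has_vector_derivative f (y s) (\<alpha> s) (dest p ps j)) (at s))"
  unfolding switching_solution_def
  using ball_stages_iff[of m "\<lambda>i j. AE s in lebesgue. s \<in> {instant t ts i..instant t ts j} \<longrightarrow>
        (y has_vector_derivative f (y s) (\<alpha> s) (dest p ps i)) (at s)"]
  by simp

lemma switching_solution_last_iff: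
  "switching_solution f x t p (\<alpha>, Suc 0, [\<tau>], []) y \<longleftrightarrow>
     caratheodory_solution (\<lambda>s z. f z (\<alpha> s) p) t \<tau> x y"
  by (auto simp: switching_solution_iff caratheodory_solution_def)

lemma switching_solution_step_iff:
  "switching_solution f x t p (\<alpha>, Suc m, \<tau> # ts, q # ps) y \<longleftrightarrow>
     abs_cont_on t (instant \<tau> ts m) y \<and> y t = x \<and>
     (AE s in lebesgue. s \<in> {t..\<tau>} \<longrightarrow> (y has_vector_derivative f (y s) (\<alpha> s) p) (at s)) \<and>
     (\<forall>j<m. AE s in lebesgue. s \<in> {instant \<tau> ts j..instant \<tau> ts (Suc j)} \<longrightarrow>
        (y has_vector_derivative f (y s) (\<alpha> s) (dest q ps j)) (at s))"
  by (simp add: switching_solution_iff All_less_Suc2)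

lemma switching_solution_decompose:
  assumes "switching_solution f x t p (\<alpha>, Suc m, \<tau> # ts, q # ps) y" "t \<le> \<tau>" "\<tau> \<le> instant \<tau> ts m"
  shows "caratheodory_solution (\<lambda>s z. f z (\<alpha> s) p) t \<tau> x y"
    and "switching_solution f (y \<tau>) \<tau> q (\<alpha>, m, ts, ps) y"
  using assms unfolding switching_solution_step_iff
  by (auto simp: caratheodory_solution_def switching_solution_iff intro: abs_cont_on_subset)

section \<open>Trajectories and costs of controls\<close>

text \<open>
  The cost of the stopping problem with an arbitrary terminal cost \<open>w\<close>, so that the same expression
  serves with the cost of a continuation, with its optimal value, and with the recursively defined
  stopping value.
\<close>

definition stopping_cost ::
  "('d::finite, 'm::finite, 'n::finite) dynamics \<Rightarrow> ('d, 'm, 'n) running_cost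
     \<Rightarrow> ('d, 'n) switching_cost \<Rightarrow> real \<Rightarrow> real
     \<Rightarrow> real ^ 'd \<Rightarrow> real \<Rightarrow> 'n mode \<Rightarrow> 'm control \<Rightarrow> real \<Rightarrow> 'n mode
     \<Rightarrow> (real ^ 'd \<Rightarrow> real \<Rightarrow> real) \<Rightarrow> real" where
  "stopping_cost f \<l> C lam T x t p \<alpha> \<tau> q w =
     (let y = stopping_trajectory f T x t p \<alpha> in
        (LINT s:{t..\<tau>}|lebesgue. exp (- lam * (s - t)) * \<l> (y s) (\<alpha> s) p s)
        + exp (- lam * (\<tau> - t)) * (C (y \<tau>) p q + w (y \<tau>) \<tau>))"

locale switching_system =
  fixes f :: "('d::finite, 'm::finite, 'n::finite) dynamics"
    and \<l> :: "('d, 'm, 'n) running_cost"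
    and C :: "('d, 'n) switching_cost"
    and A :: "(real ^ 'm) set"
    and lam T M L :: real
  assumes lam_nonneg: "0 \<le> lam"
    and A_nonempty: "A \<noteq> {}"
    and f_continuous: "\<And>p. continuous_on (UNIV \<times> A) (\<lambda>(x, a). f x a p)"
    and f_bounded: "\<And>x a p. a \<in> A \<Longrightarrow> norm (f x a p) \<le> M"
    and L_pos: "0 < L"
    and f_lipschitz: "\<And>x y a p. a \<in> A \<Longrightarrow> norm (f x a p - f y a p) \<le> L * norm (x - y)"
    and l_nonneg: "\<And>x a p t. a \<in> A \<Longrightarrow> t \<in> {0..T} \<Longrightarrow> 0 \<le> \<l> x a p t"
    and C_nonneg: "\<And>x p q. 0 \<le> C x p q"
begin

abbreviation "flow \<alpha> p \<equiv> caratheodory_solution (\<lambda>s z. f z (\<alpha> s) p)"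
abbreviation "stop_cost \<equiv> stopping_cost f \<l> C lam T"
abbreviation "J \<equiv> switching_J f \<l> C lam"
abbreviation "V z s p \<equiv> switching_value f \<l> C A lam T z s p"

lemma control_in: "\<alpha> \<in> controls A \<Longrightarrow> 0 \<le> s \<Longrightarrow> \<alpha> s \<in> A"
  using measurable_space[of \<alpha> "lebesgue_on {0..}" "restrict_space borel A" s]
  by (simp add: controls_def space_restrict_space)

lemma velocity_measurable:
  assumes "\<alpha> \<in> controls A" "0 \<le> a" "continuous_on {a..b} y"
  shows "(\<lambda>s. f (y s) (\<alpha> s) p) \<in> borel_measurable (lebesgue_on {a..b})"
proof -
  have "\<alpha> \<in> measurable (lebesgue_on {a..b}) (restrict_space borel A)"
    using assms unfolding controls_def by (rule_tac measurable_restrict_mono) auto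
  then have \<alpha>: "\<alpha> \<in> borel_measurable (lebesgue_on {a..b})"
    by (simp add: measurable_restrict_space2_iff)
  have y: "y \<in> borel_measurable (lebesgue_on {a..b})"
    using assms(3) by (intro continuous_imp_measurable_on_sets_lebesgue) auto
  have "(\<lambda>s. (y s, \<alpha> s)) \<in> measurable (lebesgue_on {a..b}) (restrict_space borel (UNIV \<times> A))"
    using y \<alpha> control_in[OF assms(1)] assms(2)
    by (intro measurable_restrict_space2 borel_measurable_Pair) (auto simp: space_restrict_space)
  from measurable_compose[OF this borel_measurable_continuous_on_restrict[OF f_continuous[of p]]]
  show ?thesis by simp
qed

lemma flow_exists:
  assumes "\<alpha> \<in> controls A" "0 \<le> a" "a \<le> b"
  obtains y where "flow \<alpha> p a b x y" "M-lipschitz_on {a..b} y"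
proof (rule caratheodory_exists[OF \<open>a \<le> b\<close>, where g = "\<lambda>s z. f z (\<alpha> s) p" and M = M and L = L and x = x])
  have \<alpha>: "\<alpha> s \<in> A" if "s \<in> {a..b}" for s
    using control_in[OF assms(1)] assms(2) that by simp
  show "(\<lambda>s. f (y s) (\<alpha> s) p) \<in> borel_measurable (lebesgue_on {a..b})"
    if "continuous_on {a..b} y" for y
    using velocity_measurable assms that by blast
  show "norm (f z (\<alpha> s) p) \<le> M" if "s \<in> {a..b}" for s z
    by (rule f_bounded[OF \<alpha>[OF that]])
  show "norm (f z (\<alpha> s) p - f w (\<alpha> s) p) \<le> L * norm (z - w)" if "s \<in> {a..b}" for s z w
    by (rule f_lipschitz[OF \<alpha>[OF that]])
qed (use that L_pos in auto)

lemma flow_unique: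
  assumes "flow \<alpha> p a b x y" "flow \<alpha> p a b x y'" "\<alpha> \<in> controls A" "0 \<le> a" "s \<in> {a..b}"
  shows "y s = y' s"
proof (rule caratheodory_unique[OF assms(1,2) _ L_pos assms(5)])
  fix s z w assume "s \<in> {a..b}"
  then have "\<alpha> s \<in> A" using control_in[OF assms(3)] assms(4) by simp
  then show "norm (f z (\<alpha> s) p - f w (\<alpha> s) p) \<le> L * norm (z - w)" by (rule f_lipschitz)
qed

lemma stopping_trajectory_flow:
  assumes "\<alpha> \<in> controls A" "0 \<le> t" "t \<le> T"
  shows "flow \<alpha> p t T x (stopping_trajectory f T x t p \<alpha>)"
proof -
  obtain y where "flow \<alpha> p t T x y" using flow_exists[OF assms] by blast
  then have "stopping_solution f T x t p \<alpha> (stopping_trajectory f T x t p \<alpha>)"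
    unfolding stopping_trajectory_def stopping_solution_iff_caratheodory[symmetric]
    by (rule someI[of "stopping_solution f T x t p \<alpha>"])
  then show ?thesis by (simp add: stopping_solution_iff_caratheodory)
qed

lemma stopping_trajectory_eq:
  assumes "\<alpha> \<in> controls A" "0 \<le> t" "t \<le> \<tau>" "\<tau> \<le> T" "flow \<alpha> p t \<tau> x y" "s \<in> {t..\<tau>}"
  shows "stopping_trajectory f T x t p \<alpha> s = y s"
proof -
  let ?z = "stopping_trajectory f T x t p \<alpha>"
  have "flow \<alpha> p t T x ?z" using assms by (intro stopping_trajectory_flow) auto
  moreover from this have "?z t = x" by (simp add: caratheodory_solution_def)
  ultimately have "flow \<alpha> p t \<tau> x ?z"
    using caratheodory_solution_subinterval[of _ t T x ?z t \<tau>] assms by auto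
  then show ?thesis using flow_unique assms by blast
qed

text \<open>
  By uniqueness the trajectories agree up to and including \<open>\<tau>\<close>; the integrands may differ only at \<open>\<tau>\<close>.
\<close>

lemma stopping_cost_change_control:
  assumes "\<alpha> \<in> controls A" "\<alpha>' \<in> controls A" "0 \<le> t" "t \<le> \<tau>" "\<tau> \<le> T"
    and eq: "\<And>s. s \<in> {t..<\<tau>} \<Longrightarrow> \<alpha> s = \<alpha>' s"
  shows "stop_cost x t p \<alpha> \<tau> q w = stop_cost x t p \<alpha>' \<tau> q w"
proof -
  let ?y = "stopping_trajectory f T x t p \<alpha>" and ?z = "stopping_trajectory f T x t p \<alpha>'"
  have "flow \<alpha> p t T x ?y" using assms by (intro stopping_trajectory_flow) auto
  moreover from this have "?y t = x" by (simp add: caratheodory_solution_def)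
  ultimately have "flow \<alpha> p t \<tau> x ?y"
    using caratheodory_solution_subinterval[of _ t T x ?y t \<tau>] assms by auto
  then have "flow \<alpha>' p t \<tau> x ?y"
    by (rule caratheodory_solution_change_endpoint) (simp add: eq)
  then have traj: "?z s = ?y s" if "s \<in> {t..\<tau>}" for s
    using stopping_trajectory_eq assms that by blast
  have "(LINT s:{t..\<tau>}|lebesgue. exp (- lam * (s - t)) * \<l> (?y s) (\<alpha> s) p s)
      = (LINT s:{t..\<tau>}|lebesgue. exp (- lam * (s - t)) * \<l> (?z s) (\<alpha>' s) p s)"
    unfolding set_lebesgue_integral_def
    by (rule integral_discrete_difference[where X = "{\<tau>}"]) (auto simp: traj eq indicator_def)
  then show ?thesis using traj[of \<tau>] assms by (simp add: stopping_cost_def Let_def)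
qed

lemma stopping_cost_nonneg:
  assumes "\<alpha> \<in> controls A" "0 \<le> t" "\<tau> \<in> {t..T}" "\<And>z. 0 \<le> w z \<tau>"
  shows "0 \<le> stop_cost x t p \<alpha> \<tau> q w"
proof -
  have "0 \<le> indicator {t..\<tau>} s *\<^sub>R (exp (- lam * (s - t)) * \<l> z (\<alpha> s) p s)" for s z
    using assms l_nonneg[of "\<alpha> s" s z p] control_in[OF assms(1), of s] by (auto simp: indicator_def)
  then have "0 \<le> (LINT s:{t..\<tau>}|lebesgue. exp (- lam * (s - t)) * \<l> (y s) (\<alpha> s) p s)" for y
    unfolding set_lebesgue_integral_def by (intro Bochner_Integration.integral_nonneg) blast
  then show ?thesis
    using assms(4) C_nonneg by (auto simp: stopping_cost_def Let_def)
qed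

text \<open>
  The discount factor of the terminal cost lies in \<open>[0, 1]\<close>, so an error \<open>e\<close> in the terminal cost is not
  amplified.
\<close>

lemma stopping_cost_le:
  assumes "w (stopping_trajectory f T x t p \<alpha> \<tau>) \<tau> \<le> w' (stopping_trajectory f T x t p \<alpha> \<tau>) \<tau> + e"
    and "0 \<le> e" "t \<le> \<tau>"
  shows "stop_cost x t p \<alpha> \<tau> q w \<le> stop_cost x t p \<alpha> \<tau> q w' + e"
proof -
  define z where "z = stopping_trajectory f T x t p \<alpha> \<tau>"
  define k where "k = exp (- lam * (\<tau> - t))"
  have "0 \<le> k" "k \<le> 1" using lam_nonneg \<open>t \<le> \<tau>\<close> by (auto simp: k_def)
  have "k * (C z p q + w z \<tau>) \<le> k * (C z p q + w' z \<tau> + e)"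
    using assms(1) \<open>0 \<le> k\<close> by (intro mult_left_mono) (auto simp: z_def)
  also have "\<dots> \<le> k * (C z p q + w' z \<tau>) + e"
    using mult_right_mono[OF \<open>k \<le> 1\<close> \<open>0 \<le> e\<close>] by (simp add: algebra_simps)
  finally show ?thesis by (simp add: stopping_cost_def Let_def z_def k_def)
qed

text \<open>
  The solutions of the successive stages are concatenated. At the switching instants the derivative from
  the left and the one from the right differ in general, but these instants form a null set.
\<close>

lemma switching_solution_exists:
  assumes "schedule T p t ts ps" "0 \<le> t" "\<alpha> \<in> controls A"
  shows "\<exists>y. switching_solution f x t p (\<alpha>, length ts, ts, ps) y \<and>
             M-lipschitz_on {t..instant t ts (length ts)} y"
  using assms
proof (induction arbitrary: x rule: schedule.induct)
  case (last t \<tau> p)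
  then obtain y where "flow \<alpha> p t \<tau> x y" "M-lipschitz_on {t..\<tau>} y"
    using flow_exists by blast
  then show ?case by (auto simp: switching_solution_last_iff)
next
  case (step t \<tau> q p ts ps)
  obtain y1 where y1: "flow \<alpha> p t \<tau> x y1" "M-lipschitz_on {t..\<tau>} y1"
    using flow_exists step by blast
  obtain y2 where y2: "switching_solution f (y1 \<tau>) \<tau> q (\<alpha>, length ts, ts, ps) y2"
    "M-lipschitz_on {\<tau>..instant \<tau> ts (length ts)} y2"
    using step.IH[of "y1 \<tau>"] step by auto
  define y where "y s = (if s \<le> \<tau> then y1 s else y2 s)" for s
  have "y1 \<tau> = y2 \<tau>" using y2(1) by (simp add: switching_solution_iff)
  then have lip: "M-lipschitz_on {t..instant \<tau> ts (length ts)} y"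
    unfolding y_def[abs_def] by (intro lipschitz_on_concat y1 y2)
  have not_\<tau>: "AE s in lebesgue. s \<notin> {\<tau>}" by (rule AE_lebesgue_not_in_finite) simp
  have "AE s in lebesgue. s \<in> {t..\<tau>} \<longrightarrow> (y1 has_vector_derivative f (y1 s) (\<alpha> s) p) (at s)"
    using y1(1) by (simp add: caratheodory_solution_def)
  with not_\<tau> have first: "AE s in lebesgue. s \<in> {t..\<tau>} \<longrightarrow> (y has_vector_derivative f (y s) (\<alpha> s) p) (at s)"
  proof eventually_elim
    case (elim s)
    show ?case
    proof
      assume "s \<in> {t..\<tau>}"
      then have s: "s < \<tau>" "(y1 has_vector_derivative f (y s) (\<alpha> s) p) (at s)"
        using elim by (auto simp: y_def)
      show "(y has_vector_derivative f (y s) (\<alpha> s) p) (at s)"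
        by (rule has_vector_derivative_transform_within_open[OF s(2), of "{..<\<tau>}"])
          (use s(1) in \<open>auto simp: y_def\<close>)
    qed
  qed
  have rest: "AE s in lebesgue. s \<in> {instant \<tau> ts j..instant \<tau> ts (Suc j)} \<longrightarrow>
        (y has_vector_derivative f (y s) (\<alpha> s) (dest q ps j)) (at s)" if "j < length ts" for j
  proof -
    have "AE s in lebesgue. s \<in> {instant \<tau> ts j..instant \<tau> ts (Suc j)} \<longrightarrow>
        (y2 has_vector_derivative f (y2 s) (\<alpha> s) (dest q ps j)) (at s)"
      using y2(1) that by (simp add: switching_solution_iff)
    with not_\<tau> show ?thesis
    proof eventually_elim
      case (elim s)
      show ?case
      proof
        assume "s \<in> {instant \<tau> ts j..instant \<tau> ts (Suc j)}"
        moreover have "\<tau> \<le> instant \<tau> ts j" using schedule_instants(1)[OF step.hyps(3)] that by simp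
        ultimately have s: "\<tau> < s" "(y2 has_vector_derivative f (y s) (\<alpha> s) (dest q ps j)) (at s)"
          using elim by (auto simp: y_def)
        show "(y has_vector_derivative f (y s) (\<alpha> s) (dest q ps j)) (at s)"
          by (rule has_vector_derivative_transform_within_open[OF s(2), of "{\<tau><..}"])
            (use s(1) in \<open>auto simp: y_def\<close>)
      qed
    qed
  qed
  have "y t = x" using y1(1) step.hyps(1) by (simp add: y_def caratheodory_solution_def)
  then have "switching_solution f x t p (\<alpha>, Suc (length ts), \<tau> # ts, q # ps) y"
    unfolding switching_solution_step_iff using first rest lipschitz_imp_abs_cont_on[OF lip] by blast
  then show ?case using lip by auto
qed

lemma switching_solution_unique:
  assumes "schedule T p t ts ps" "0 \<le> t" "\<alpha> \<in> controls A"
    and "switching_solution f x t p (\<alpha>, length ts, ts, ps) y"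
    and "switching_solution f x t p (\<alpha>, length ts, ts, ps) z"
    and "s \<in> {t..instant t ts (length ts)}"
  shows "y s = z s"
  using assms
proof (induction arbitrary: x rule: schedule.induct)
  case (last t \<tau> p)
  then show ?case using flow_unique[of \<alpha> p t \<tau> x y z s] by (simp add: switching_solution_last_iff)
next
  case (step t \<tau> q p ts ps)
  have le: "\<tau> \<le> instant \<tau> ts (length ts)" using schedule_instants(1)[OF step.hyps(3)] by simp
  note y = switching_solution_decompose[OF step.prems(3)[simplified] step.hyps(1) le]
  note z = switching_solution_decompose[OF step.prems(4)[simplified] step.hyps(1) le]
  have eq: "y r = z r" if "r \<in> {t..\<tau>}" for r
    using flow_unique[OF y(1) z(1)] step.prems that by blast
  show ?case
  proof (cases "s \<le> \<tau>")
    case True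
    then show ?thesis using eq step.prems by auto
  next
    case False
    have "switching_solution f (y \<tau>) \<tau> q (\<alpha>, length ts, ts, ps) z"
      using z(2) eq[of \<tau>] step.hyps(1) by simp
    then show ?thesis
      using step.IH[of "y \<tau>"] y(2) step.prems step.hyps(1) False by auto
  qed
qed

lemma switching_trajectory_solution:
  assumes "schedule T p t ts ps" "0 \<le> t" "\<alpha> \<in> controls A"
  shows "switching_solution f x t p (\<alpha>, length ts, ts, ps)
           (switching_trajectory f x t p (\<alpha>, length ts, ts, ps))"
proof -
  have "\<exists>y. switching_solution f x t p (\<alpha>, length ts, ts, ps) y"
    using switching_solution_exists[OF assms] by blast
  then show ?thesis
    unfolding switching_trajectory_def
    by (rule someI_ex[of "switching_solution f x t p (\<alpha>, length ts, ts, ps)"])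
qed

lemma J_last:
  assumes "\<alpha> \<in> controls A" "0 \<le> t" "t \<le> \<tau>" "\<tau> \<le> T" "final_mode \<in> reachable p"
  shows "J x t p (\<alpha>, Suc 0, [\<tau>], []) = stop_cost x t p \<alpha> \<tau> final_mode (\<lambda>_ _. 0)"
proof -
  let ?y = "switching_trajectory f x t p (\<alpha>, Suc 0, [\<tau>], [])"
  have "flow \<alpha> p t \<tau> x ?y"
    using switching_trajectory_solution[OF schedule.last[OF assms(3-5)] assms(2,1)]
    by (simp add: switching_solution_last_iff)
  then have eq: "stopping_trajectory f T x t p \<alpha> s = ?y s" if "s \<in> {t..\<tau>}" for s
    using stopping_trajectory_eq assms that by blast
  have "(LINT s:{t..\<tau>}|lebesgue. exp (- lam * (s - t)) * \<l> (?y s) (\<alpha> s) p s)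
      = (LINT s:{t..\<tau>}|lebesgue. exp (- lam * (s - t)) * \<l> (stopping_trajectory f T x t p \<alpha> s) (\<alpha> s) p s)"
    by (rule set_lebesgue_integral_cong) (auto simp: eq)
  then show ?thesis
    using assms eq[of \<tau>] by (simp add: switching_J_def stopping_cost_def Let_def)
qed

text \<open>
  The trajectory of the whole control solves the equation of the first stage on \<open>{t..\<tau>}\<close> and that of the remaining
  stages from \<open>\<tau>\<close> on. By uniqueness it coincides on \<open>{t..\<tau>}\<close> with the trajectory of the stopping problem, and
  from \<open>\<tau>\<close> on with the trajectory of the continuation. In the proof, \<open>F\<close> are the summands of the cost of the whole
  and \<open>G\<close> those of the cost of the continuation, whose discount starts at \<open>\<tau>\<close> instead of \<open>t\<close>; this accounts
  for the common factor.
\<close>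

lemma J_step:
  assumes "\<alpha> \<in> controls A" "0 \<le> t" "t \<le> \<tau>" "q \<in> reachable p" "schedule T q \<tau> ts ps"
  shows "J x t p (\<alpha>, Suc (length ts), \<tau> # ts, q # ps) =
           stop_cost x t p \<alpha> \<tau> q (\<lambda>z s. J z s q (\<alpha>, length ts, ts, ps))"
proof -
  let ?m = "length ts"
  let ?y = "switching_trajectory f x t p (\<alpha>, Suc ?m, \<tau> # ts, q # ps)"
  let ?z = "stopping_trajectory f T x t p \<alpha>"
  let ?w = "switching_trajectory f (?z \<tau>) \<tau> q (\<alpha>, ?m, ts, ps)"
  note inst = schedule_instants[OF assms(5)]
  have "\<tau> \<le> T" using inst(2)[of 0] by simp
  have y: "switching_solution f x t p (\<alpha>, Suc ?m, \<tau> # ts, q # ps) ?y"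
    using switching_trajectory_solution[OF schedule.step[OF assms(3-5)] assms(2,1)] by simp
  note dec = switching_solution_decompose[OF y assms(3) inst(1)[OF order_refl]]
  have yz: "?z s = ?y s" if "s \<in> {t..\<tau>}" for s
    using stopping_trajectory_eq[OF assms(1-3) \<open>\<tau> \<le> T\<close> dec(1) that] .
  have "switching_solution f (?z \<tau>) \<tau> q (\<alpha>, ?m, ts, ps) ?w"
    using switching_trajectory_solution[OF assms(5) _ assms(1)] assms(2,3) by simp
  moreover have "switching_solution f (?z \<tau>) \<tau> q (\<alpha>, ?m, ts, ps) ?y"
    using dec(2) yz[of \<tau>] assms(3) by simp
  ultimately have yw: "?y s = ?w s" if "s \<in> {\<tau>..instant \<tau> ts ?m}" for s
    using switching_solution_unique[OF assms(5) _ assms(1) _ _ that] assms(2,3) by auto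
  define F where "F j = (LINT s:{instant t (\<tau> # ts) (j - 1)..instant t (\<tau> # ts) j}|lebesgue.
             exp (- lam * (s - t)) * \<l> (?y s) (\<alpha> s) (dest p (q # ps) (j - 1)) s)
          + exp (- lam * (instant t (\<tau> # ts) j - t))
            * C (?y (instant t (\<tau> # ts) j)) (dest p (q # ps) (j - 1)) (dest p (q # ps) j)" for j
  define G where "G j = (LINT s:{instant \<tau> ts (j - 1)..instant \<tau> ts j}|lebesgue.
             exp (- lam * (s - \<tau>)) * \<l> (?w s) (\<alpha> s) (dest q ps (j - 1)) s)
          + exp (- lam * (instant \<tau> ts j - \<tau>))
            * C (?w (instant \<tau> ts j)) (dest q ps (j - 1)) (dest q ps j)" for j
  have shift: "exp (- lam * (s - t)) = exp (- lam * (\<tau> - t)) * exp (- lam * (s - \<tau>))" for s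
    by (simp add: exp_add[symmetric] algebra_simps)
  have FG: "F (Suc j) = exp (- lam * (\<tau> - t)) * G j" if j: "j \<in> {1..?m}" for j
  proof -
    obtain k where k: "j = Suc k" "Suc k \<le> ?m" using j by (cases j) auto
    have mono: "instant \<tau> ts (Suc k) \<le> instant \<tau> ts ?m" by (rule inst(3)[OF k(2)])
    have "(LINT s:{instant \<tau> ts k..instant \<tau> ts (Suc k)}|lebesgue.
             exp (- lam * (s - t)) * \<l> (?y s) (\<alpha> s) (dest q ps k) s)
        = (LINT s:{instant \<tau> ts k..instant \<tau> ts (Suc k)}|lebesgue.
             exp (- lam * (\<tau> - t)) * (exp (- lam * (s - \<tau>)) * \<l> (?w s) (\<alpha> s) (dest q ps k) s))"
    proof (rule set_lebesgue_integral_cong, simp, safe)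
      fix s assume "s \<in> {instant \<tau> ts k..instant \<tau> ts (Suc k)}"
      then have "?y s = ?w s" using mono inst(1)[of k] k(2) by (intro yw) auto
      then show "exp (- lam * (s - t)) * \<l> (?y s) (\<alpha> s) (dest q ps k) s
        = exp (- lam * (\<tau> - t)) * (exp (- lam * (s - \<tau>)) * \<l> (?w s) (\<alpha> s) (dest q ps k) s)"
        by (simp only: shift[of s] mult.assoc)
    qed
    also have "\<dots> = exp (- lam * (\<tau> - t)) * (LINT s:{instant \<tau> ts k..instant \<tau> ts (Suc k)}|lebesgue.
             exp (- lam * (s - \<tau>)) * \<l> (?w s) (\<alpha> s) (dest q ps k) s)"
      by (rule set_integral_mult_right)
    finally have "(LINT s:{instant \<tau> ts k..instant \<tau> ts (Suc k)}|lebesgue.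
             exp (- lam * (s - t)) * \<l> (?y s) (\<alpha> s) (dest q ps k) s) = \<dots>" .
    moreover have "?y (instant \<tau> ts (Suc k)) = ?w (instant \<tau> ts (Suc k))"
      using mono inst(1)[of "Suc k"] k(2) by (intro yw) auto
    ultimately show ?thesis
      unfolding F_def G_def k(1) using shift[of "instant \<tau> ts (Suc k)"]
      by (simp add: distrib_left mult.assoc)
  qed
  have "(LINT s:{t..\<tau>}|lebesgue. exp (- lam * (s - t)) * \<l> (?y s) (\<alpha> s) p s)
      = (LINT s:{t..\<tau>}|lebesgue. exp (- lam * (s - t)) * \<l> (?z s) (\<alpha> s) p s)"
    by (rule set_lebesgue_integral_cong) (auto simp: yz)
  then have F1: "F 1 = (LINT s:{t..\<tau>}|lebesgue. exp (- lam * (s - t)) * \<l> (?z s) (\<alpha> s) p s)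
      + exp (- lam * (\<tau> - t)) * C (?z \<tau>) p q"
    using yz[of \<tau>] assms(3) by (simp add: F_def)
  have "J x t p (\<alpha>, Suc ?m, \<tau> # ts, q # ps) = (\<Sum>j=1..Suc ?m. F j)"
    by (simp only: switching_J_def Let_def prod.case F_def)
  also have "\<dots> = F 1 + (\<Sum>j=1..?m. F (Suc j))"
    unfolding One_nat_def sum.shift_bounds_cl_Suc_ivl by (rule sum.atLeast_Suc_atMost) simp
  also have "(\<Sum>j=1..?m. F (Suc j)) = (\<Sum>j=1..?m. exp (- lam * (\<tau> - t)) * G j)"
    by (intro sum.cong FG) auto
  also have "\<dots> = exp (- lam * (\<tau> - t)) * (\<Sum>j=1..?m. G j)"
    by (simp only: sum_distrib_left)
  also have "(\<Sum>j=1..?m. G j) = J (?z \<tau>) \<tau> q (\<alpha>, ?m, ts, ps)"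
    by (simp only: switching_J_def Let_def prod.case G_def)
  finally show ?thesis
    unfolding F1 by (simp add: stopping_cost_def Let_def distrib_left)
qed

lemma J_nonneg:
  assumes "schedule T p t ts ps" "0 \<le> t" "\<alpha> \<in> controls A"
  shows "0 \<le> J x t p (\<alpha>, length ts, ts, ps)"
  using assms
proof (induction arbitrary: x rule: schedule.induct)
  case (last t \<tau> p)
  then show ?case by (auto simp: J_last intro!: stopping_cost_nonneg)
next
  case (step t \<tau> q p ts ps)
  have "\<tau> \<le> T" using schedule_instants(2)[OF step.hyps(3), of 0] by simp
  have "0 \<le> stop_cost x t p \<alpha> \<tau> q (\<lambda>z s. J z s q (\<alpha>, length ts, ts, ps))"
    using step \<open>\<tau> \<le> T\<close> by (intro stopping_cost_nonneg) auto
  then show ?case using step by (simp add: J_step)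
qed

text \<open>
  A continuation that starts at time \<open>t\<close> does not see the part of a glued control before \<open>t\<close>.
\<close>

lemma J_change_control:
  assumes "schedule T p t ts ps" "0 \<le> t" "\<alpha> \<in> controls A" "\<alpha>' \<in> controls A"
    and "\<And>s. t \<le> s \<Longrightarrow> \<alpha> s = \<alpha>' s"
  shows "J x t p (\<alpha>, length ts, ts, ps) = J x t p (\<alpha>', length ts, ts, ps)"
  using assms
proof (induction arbitrary: x rule: schedule.induct)
  case (last t \<tau> p)
  then show ?case using stopping_cost_change_control[of \<alpha> \<alpha>' t \<tau>] by (simp add: J_last)
next
  case (step t \<tau> q p ts ps)
  have "\<tau> \<le> T" using schedule_instants(2)[OF step.hyps(3), of 0] by simp
  have IH: "J z \<tau> q (\<alpha>, length ts, ts, ps) = J z \<tau> q (\<alpha>', length ts, ts, ps)" for z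
    using step by auto
  have "stop_cost x t p \<alpha> \<tau> q (\<lambda>z s. J z s q (\<alpha>, length ts, ts, ps))
      = stop_cost x t p \<alpha>' \<tau> q (\<lambda>z s. J z s q (\<alpha>, length ts, ts, ps))"
    using step \<open>\<tau> \<le> T\<close> by (intro stopping_cost_change_control) auto
  also have "\<dots> = stop_cost x t p \<alpha>' \<tau> q (\<lambda>z s. J z s q (\<alpha>', length ts, ts, ps))"
    by (simp add: stopping_cost_def IH)
  finally show ?case using step by (simp add: J_step)
qed

section \<open>The dynamic programming principle\<close>

lemma switching_value_eq_INF_schedules:
  assumes "p \<noteq> final_mode"
  shows "V x t p = (INF (\<alpha>, ts, ps) \<in> {(\<alpha>, ts, ps). \<alpha> \<in> controls A \<and> schedule T p t ts ps}.
                     J x t p (\<alpha>, length ts, ts, ps))"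
proof -
  have "switching_controls A T p t = (\<lambda>(\<alpha>, ts, ps). (\<alpha>, length ts, ts, ps)) `
          {(\<alpha>, ts, ps). \<alpha> \<in> controls A \<and> schedule T p t ts ps}"
    by (auto simp: switching_controls_eq_schedules image_iff)
  then show ?thesis
    using assms by (simp add: switching_value_def image_image case_prod_unfold)
qed

lemma switching_value_le_J:
  assumes "schedule T p t ts ps" "\<alpha> \<in> controls A" "0 \<le> t"
  shows "V x t p \<le> J x t p (\<alpha>, length ts, ts, ps)"
  unfolding switching_value_eq_INF_schedules[OF schedule_not_final[OF assms(1)]]
proof (rule cINF_lower2[where x = "(\<alpha>, ts, ps)"])
  show "bdd_below ((\<lambda>(\<alpha>, ts, ps). J x t p (\<alpha>, length ts, ts, ps)) `
      {(\<alpha>, ts, ps). \<alpha> \<in> controls A \<and> schedule T p t ts ps})"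
    by (rule bdd_belowI[of _ 0]) (use assms(3) J_nonneg in auto)
qed (use assms in auto)

lemma controls_nonempty: "controls A \<noteq> {}"
proof -
  obtain a where "a \<in> A" using A_nonempty by blast
  then have "(\<lambda>_. a) \<in> controls A" by (simp add: controls_def space_restrict_space)
  then show ?thesis by blast
qed

lemma schedules_nonempty:
  assumes "p \<noteq> final_mode" "t \<le> T"
  shows "{(\<alpha>, ts, ps). \<alpha> \<in> controls A \<and> schedule T p t ts ps} \<noteq> {}"
  using controls_nonempty schedule.last[of t t T p] assms by (auto simp: final_mode_in_reachable)

lemma switching_value_nonneg:
  assumes "0 \<le> t" "t \<le> T"
  shows "0 \<le> V x t p"
proof (cases "p = final_mode")
  case True then show ?thesis by (simp add: switching_value_def)
next
  case False
  show ?thesis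
    unfolding switching_value_eq_INF_schedules[OF False]
    by (rule cINF_greatest[OF schedules_nonempty[OF False assms(2)]]) (use assms J_nonneg in auto)
qed

lemma controls_concat:
  assumes "\<alpha> \<in> controls A" "\<beta> \<in> controls A"
  shows "(\<lambda>s. if s < \<tau> then \<alpha> s else \<beta> s) \<in> controls A"
  using assms unfolding controls_def
  by (intro measurable_If) (auto intro!: sets_restrict_space_iff[THEN iffD2] simp: space_restrict_space)

text \<open>
  The competitor follows \<open>\<alpha>\<close> before \<open>\<tau>\<close>, and from \<open>\<tau>\<close> on a continuation that is optimal up to \<open>e\<close>.
\<close>

lemma switching_value_le_stopping_cost:
  assumes \<alpha>: "\<alpha> \<in> controls A" and t: "0 \<le> t" "t \<le> \<tau>" "\<tau> \<le> T" and q: "q \<in> reachable p"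
  shows "V x t p \<le> stop_cost x t p \<alpha> \<tau> q (\<lambda>z s. V z s q)"
proof (cases "q = final_mode")
  case True
  then have "V x t p \<le> J x t p (\<alpha>, Suc 0, [\<tau>], [])"
    using switching_value_le_J[OF schedule.last[OF t(2,3)] \<alpha> t(1)] q by simp
  then show ?thesis
    using J_last[OF \<alpha> t] q True by (simp add: switching_value_def)
next
  case False
  let ?z = "stopping_trajectory f T x t p \<alpha> \<tau>"
  let ?S = "{(\<alpha>, ts, ps). \<alpha> \<in> controls A \<and> schedule T q \<tau> ts ps}"
  show ?thesis
  proof (rule field_le_epsilon)
    fix e :: real assume "e > 0"
    have "\<exists>u\<in>?S. (case u of (\<beta>, ts, ps) \<Rightarrow> J ?z \<tau> q (\<beta>, length ts, ts, ps)) < V ?z \<tau> q + e"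
    proof (rule ccontr)
      assume "\<not> ?thesis"
      then have "V ?z \<tau> q + e \<le> V ?z \<tau> q"
        unfolding switching_value_eq_INF_schedules[OF False, of ?z \<tau>]
        by (intro cINF_greatest schedules_nonempty[OF False t(3)]) (auto simp: not_less)
      then show False using \<open>e > 0\<close> by simp
    qed
    then obtain \<beta> ts ps where u: "\<beta> \<in> controls A" "schedule T q \<tau> ts ps"
      "J ?z \<tau> q (\<beta>, length ts, ts, ps) < V ?z \<tau> q + e" by auto
    define \<gamma> where "\<gamma> s = (if s < \<tau> then \<alpha> s else \<beta> s)" for s
    have \<gamma>: "\<gamma> \<in> controls A" unfolding \<gamma>_def[abs_def] by (rule controls_concat[OF \<alpha> u(1)])
    have J\<gamma>: "J z \<tau> q (\<gamma>, length ts, ts, ps) = J z \<tau> q (\<beta>, length ts, ts, ps)" for z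
      using t by (intro J_change_control[OF u(2) _ \<gamma> u(1)]) (auto simp: \<gamma>_def)
    have "V x t p \<le> J x t p (\<gamma>, length (\<tau> # ts), \<tau> # ts, q # ps)"
      by (rule switching_value_le_J[OF schedule.step[OF t(2) q u(2)] \<gamma> t(1)])
    also have "\<dots> = stop_cost x t p \<gamma> \<tau> q (\<lambda>z s. J z s q (\<gamma>, length ts, ts, ps))"
      using J_step[OF \<gamma> t(1,2) q u(2)] by simp
    also have "\<dots> = stop_cost x t p \<alpha> \<tau> q (\<lambda>z s. J z s q (\<gamma>, length ts, ts, ps))"
      using t by (intro stopping_cost_change_control[OF \<gamma> \<alpha>]) (auto simp: \<gamma>_def)
    also have "\<dots> \<le> stop_cost x t p \<alpha> \<tau> q (\<lambda>z s. V z s q) + e"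
      using u(3) \<open>e > 0\<close> t(2) by (intro stopping_cost_le) (auto simp: J\<gamma>)
    finally show "V x t p \<le> stop_cost x t p \<alpha> \<tau> q (\<lambda>z s. V z s q) + e" .
  qed
qed

text \<open>
  The strategy is the first stage of the given switching control. The continuation after the first switch
  costs at least the value of the mode reached.
\<close>

lemma stopping_cost_le_J:
  assumes "schedule T p t ts ps" "\<alpha> \<in> controls A" "0 \<le> t"
  shows "\<exists>\<tau>\<in>{t..T}. \<exists>q\<in>reachable p.
           stop_cost x t p \<alpha> \<tau> q (\<lambda>z s. V z s q) \<le> J x t p (\<alpha>, length ts, ts, ps)"
  using assms(1)
proof cases
  case (last \<tau>)
  then have "J x t p (\<alpha>, length ts, ts, ps) = stop_cost x t p \<alpha> \<tau> final_mode (\<lambda>z s. V z s final_mode)"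
    using J_last[OF assms(2,3)] by (simp add: switching_value_def)
  then show ?thesis using last by (intro bexI[of _ \<tau>] bexI[of _ final_mode]) auto
next
  case (step \<tau> q ts' ps')
  have "\<tau> \<le> T" using schedule_instants(2)[OF step(5), of 0] by simp
  have "stop_cost x t p \<alpha> \<tau> q (\<lambda>z s. V z s q)
      \<le> stop_cost x t p \<alpha> \<tau> q (\<lambda>z s. J z s q (\<alpha>, length ts', ts', ps')) + 0"
    using switching_value_le_J[OF step(5) assms(2)] assms(3) step(3) by (intro stopping_cost_le) auto
  also have "\<dots> = J x t p (\<alpha>, length ts, ts, ps)"
    using J_step[OF assms(2,3) step(3-5)] by (simp add: step(1,2))
  finally show ?thesis using step \<open>\<tau> \<le> T\<close> by (intro bexI[of _ \<tau>] bexI[of _ q]) auto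
qed

theorem dynamic_programming_first_switch:
  assumes "0 \<le> t" "t \<le> T" "p \<noteq> final_mode"
  shows "V x t p = (INF (\<alpha>, \<tau>, q) \<in> controls A \<times> {t..T} \<times> reachable p.
                      stop_cost x t p \<alpha> \<tau> q (\<lambda>z s. V z s q))"
    (is "_ = (INF u \<in> ?S. ?F u)")
proof (rule antisym)
  have "?S \<noteq> {}"
    using controls_nonempty assms by (auto simp: final_mode_in_reachable)
  then show "V x t p \<le> (INF u \<in> ?S. ?F u)"
    by (rule cINF_greatest) (use assms switching_value_le_stopping_cost in auto)
  have bdd: "bdd_below (?F ` ?S)"
    by (rule bdd_belowI[of _ 0]) (use assms in \<open>auto intro!: stopping_cost_nonneg switching_value_nonneg\<close>)
  show "(INF u \<in> ?S. ?F u) \<le> V x t p"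
    unfolding switching_value_eq_INF_schedules[OF assms(3), of x t]
  proof (rule cINF_greatest[OF schedules_nonempty[OF assms(3,2)]], clarify)
    fix \<alpha> ts ps assume \<alpha>: "\<alpha> \<in> controls A" and "schedule T p t ts ps"
    from stopping_cost_le_J[OF this(2,1) assms(1)] obtain \<tau> q where
      "\<tau> \<in> {t..T}" "q \<in> reachable p" and
      le: "stop_cost x t p \<alpha> \<tau> q (\<lambda>z s. V z s q) \<le> J x t p (\<alpha>, length ts, ts, ps)" by blast
    then have "(INF u \<in> ?S. ?F u) \<le> ?F (\<alpha>, \<tau>, q)"
      using \<alpha> by (intro cINF_lower[OF bdd]) auto
    then show "(INF u \<in> ?S. ?F u) \<le> J x t p (\<alpha>, length ts, ts, ps)" using le by simp
  qed
qed

lemma stopping_value_unfold: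
  assumes "p \<noteq> final_mode"
  shows "stopping_value f \<l> C A lam T p x t =
    (INF (\<alpha>, \<tau>, q) \<in> controls A \<times> {t..T} \<times> reachable p.
       stop_cost x t p \<alpha> \<tau> q (\<lambda>z s. stopping_value f \<l> C A lam T q z s))"
  unfolding stopping_cost_def by (subst stopping_value.simps) (simp add: assms)

text \<open>
  Both value functions satisfy the same recursion over the modes that are reachable in one switch.
\<close>

theorem switching_value_eq_stopping_value:
  assumes "0 \<le> t" "t \<le> T"
  shows "V x t p = stopping_value f \<l> C A lam T p x t"
  using assms
proof (induction p arbitrary: x t rule: measure_induct_rule[of zeros])
  case (less p)
  show ?case
  proof (cases "p = final_mode")
    case True
    then show ?thesis by (simp add: switching_value_def stopping_value.simps)
  next
    case False
    have "stop_cost x t p \<alpha> \<tau> q (\<lambda>z s. V z s q)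
        = stop_cost x t p \<alpha> \<tau> q (\<lambda>z s. stopping_value f \<l> C A lam T q z s)"
      if "\<tau> \<in> {t..T}" "q \<in> reachable p" for \<alpha> \<tau> q
      using less.IH[OF zeros_reachable[OF that(2)], of \<tau>] less.prems that(1)
      by (simp add: stopping_cost_def)
    then show ?thesis
      unfolding dynamic_programming_first_switch[OF less.prems False] stopping_value_unfold[OF False]
      by (intro INF_cong) auto
  qed
qed

end

theorem proposition4:
  fixes f :: "real ^ 'd \<Rightarrow> real ^ 'm \<Rightarrow> bool ^ 'n \<Rightarrow> real ^ 'd"
    and \<l> :: "real ^ 'd \<Rightarrow> real ^ 'm \<Rightarrow> bool ^ 'n \<Rightarrow> real \<Rightarrow> real"
    and C :: "real ^ 'd \<Rightarrow> bool ^ 'n \<Rightarrow> bool ^ 'n \<Rightarrow> real"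
    and A :: "(real ^ 'm) set"
    and lam T :: real
  assumes "T > 0" and "lam \<ge> 0"
    and "compact A" and "A \<noteq> {}"
    and "continuous_on (UNIV \<times> A \<times> UNIV) (\<lambda>(x, a, p). f x a p)"
    and "bounded ((\<lambda>(x, a, p). f x a p) ` (UNIV \<times> A \<times> UNIV))"
    and "\<exists>L>0. \<forall>x y. \<forall>a\<in>A. \<forall>p. norm (f x a p - f y a p) \<le> L * norm (x - y)"
    and "\<forall>x. \<forall>a\<in>A. \<forall>p. \<forall>t\<in>{0..T}. 0 \<le> \<l> x a p t"
    and "bounded ((\<lambda>(x, a, p, t). \<l> x a p t) ` (UNIV \<times> A \<times> UNIV \<times> {0..T}))"
    and "continuous_on (UNIV \<times> A \<times> UNIV \<times> {0..T}) (\<lambda>(x, a, p, t). \<l> x a p t)"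
    and "\<forall>\<epsilon>>0. \<exists>\<delta>>0. \<forall>x y. \<forall>a\<in>A. \<forall>p. \<forall>t\<in>{0..T}.
           norm (x - y) < \<delta> \<longrightarrow> \<bar>\<l> x a p t - \<l> y a p t\<bar> < \<epsilon>"
    and "\<forall>x p p'. 0 \<le> C x p p'"
    and "\<forall>\<epsilon>>0. \<exists>\<delta>>0. \<forall>x y p. \<forall>p'\<in>reachable p.
           norm (x - y) < \<delta> \<longrightarrow> \<bar>C x p p' - C y p p'\<bar> < \<epsilon>"
  shows "(\<forall>x. \<forall>t\<in>{0..T}. \<forall>p. p \<noteq> final_mode \<longrightarrow>
            switching_value f \<l> C A lam T x t p =
              (INF (\<alpha>, \<tau>, p') \<in> controls A \<times> {t..T} \<times> reachable p.
                (let y = stopping_trajectory f T x t p \<alpha> in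
                   (LINT s:{t..\<tau>}|lebesgue. exp (- lam * (s - t)) * \<l> (y s) (\<alpha> s) p s)
                   + exp (- lam * (\<tau> - t))
                     * (C (y \<tau>) p p' + stopping_value f \<l> C A lam T p' (y \<tau>) \<tau>))))
       \<and> (\<forall>x. \<forall>t\<in>{0..T}. \<forall>p.
            switching_value f \<l> C A lam T x t p = stopping_value f \<l> C A lam T p x t)"
proof -
  obtain L where L: "L > 0" "\<And>x y a p. a \<in> A \<Longrightarrow> norm (f x a p - f y a p) \<le> L * norm (x - y)"
    using assms(7) by blast
  obtain M where M: "\<And>x a p. a \<in> A \<Longrightarrow> norm (f x a p) \<le> M"
    using assms(6) by (auto simp: bounded_iff)
  have cont: "continuous_on (UNIV \<times> A) (\<lambda>(x, a). f x a p)" for p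
  proof -
    have "continuous_on (UNIV \<times> A) (\<lambda>z. (\<lambda>(x, a, p). f x a p) (fst z, snd z, p))"
      by (rule continuous_on_compose2[OF assms(5)]) (auto intro!: continuous_intros)
    then show ?thesis by (simp add: case_prod_unfold)
  qed
  interpret switching_system f \<l> C A lam T M L
    using assms(2,4,8,12) L M cont by unfold_locales auto
  have eq: "switching_value f \<l> C A lam T x t p = stopping_value f \<l> C A lam T p x t"
    if "t \<in> {0..T}" for x t p
    using that by (intro switching_value_eq_stopping_value) auto
  show ?thesis
    using eq stopping_value_unfold unfolding stopping_cost_def by simp
qed

end
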